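(* Let $G_\infty=\mathbb{N}\times\mathbb{N}$ be the directed lattice graph with vertex set $V_\infty=\{v_{i,j}: i,j\in\mathbb{N}\}$ whose edges are exactly $v_{i,j}\to v_{i,j+1}$ and $v_{i,j}\to v_{i+1,j}$ ($i,j\in\mathbb{N}$), and let $\mu=(\mu_v)_{v\in V_\infty}$ be a weight on $V_\infty$. Let $B$ be the backward shift on $G_\infty$ and let $X$ be any of the spaces $\ell^p(V_\infty,\mu)$, $1\le p<\infty$, or $c_0(V_\infty,\mu)$. Assume that $B$ is bounded on $X$. 1. If $$\limsup_{i+j\to\infty}|\mu_{v_{i,j}}|^{1/(i+j)}<2,$$ then $B$ is mixing (in particular, weakly mixing and hypercyclic) on $X$. 2. Assume that there is $c>0$ such that $$|\mu_{v_{i,j}}|\ge c\,2^{i+j}\qquad\text{for all } i,j\in\mathbb{N}.$$ Then $B$ is not hypercyclic on $X$.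
   Context: Here $\mathbb{N}=\{1,2,3,\dots\}$. For a directed graph $G=(V,E)$ with countable vertex set $V$ and edge set $E\subset V\times V$, write $v\to u$ if $(v,u)\in E$, and $Chi(v)=\{u\in V: v\to u\}$ (assumed finite for each $v$). The (unweighted) backward shift acts on functions $f:V\to\mathbb{C}$ by $$(Bf)(v)=\sum_{u\in Chi(v)} f(u),\qquad v\in V.$$ A weight on $V$ is a family $\mu=(\mu_v)_{v\in V}$ of non-zero (real or complex) numbers. For $1\le p<\infty$, $$\ell^p(V,\mu)=\Big\{f:V\to\mathbb{C}:\ \|f\|^p=\sum_{v\in V}|f(v)\mu_v|^p<\infty\Big\},$$ and $c_0(V,\mu)$ is the space of $f:V\to\mathbb{C}$ such that for every $\varepsilon>0$ there is a finite $F\subset V$ with $|f(v)\mu_v|<\varepsilon$ for $v\in V\setminus F$, with norm $\|f\|=\sup_{v\in V}|f(v)\mu_v|$. "$B$ is bounded on $X$" means that $B$ maps $X$ into $X$ and is a bounded linear operator on $X$. A continuous linear operator $T$ on a separable Banach space $X$ is hypercyclic if there exists $x\in X$ such that $\{T^nx: n\ge 0\}$ is dense in $X$; it is weakly mixing if $T\oplus T$ is hypercyclic on $X\oplus X$; it is mixing if for any nonempty open sets $U,W\subset X$ there exists $N$ such that $T^n(U)\cap W\neq\emptyset$ for all $n\ge N$. *)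

theory Defs
  imports "HOL-Analysis.Analysis"
begin

text \<open>
  A directed graph is given by a vertex set \<open>V\<close> and an edge set \<open>E \<subseteq> V \<times> V\<close>. A function
  \<open>V \<rightarrow> \<complex>\<close> is represented by the total function on the ambient type that
  extends it by \<open>0\<close> outside \<open>V\<close>.
\<close>

definition graph_functions :: "'v set \<Rightarrow> ('v \<Rightarrow> complex) set" where
  "graph_functions V = {f. \<forall>v. v \<notin> V \<longrightarrow> f v = 0}"

definition children :: "('v \<times> 'v) set \<Rightarrow> 'v \<Rightarrow> 'v set" where
  "children E v = {u. (v, u) \<in> E}"

definition backward_shift ::
    "'v set \<Rightarrow> ('v \<times> 'v) set \<Rightarrow> ('v \<Rightarrow> complex) \<Rightarrow> ('v \<Rightarrow> complex)" where
  "backward_shift V E f = (\<lambda>v. if v \<in> V then \<Sum>u\<in>children E v. f u else 0)"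

definition weight_on :: "'v set \<Rightarrow> ('v \<Rightarrow> complex) \<Rightarrow> bool" where
  "weight_on V \<mu> \<longleftrightarrow> (\<forall>v\<in>V. \<mu> v \<noteq> 0)"

definition lp_space :: "real \<Rightarrow> 'v set \<Rightarrow> ('v \<Rightarrow> complex) \<Rightarrow> ('v \<Rightarrow> complex) set" where
  "lp_space p V \<mu> =
     {f \<in> graph_functions V. (\<lambda>v. cmod (f v * \<mu> v) powr p) summable_on V}"

definition lp_norm :: "real \<Rightarrow> 'v set \<Rightarrow> ('v \<Rightarrow> complex) \<Rightarrow> ('v \<Rightarrow> complex) \<Rightarrow> real" where
  "lp_norm p V \<mu> f = (\<Sum>\<^sub>\<infinity>v\<in>V. cmod (f v * \<mu> v) powr p) powr (1 / p)"

definition c0_space :: "'v set \<Rightarrow> ('v \<Rightarrow> complex) \<Rightarrow> ('v \<Rightarrow> complex) set" where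
  "c0_space V \<mu> =
     {f \<in> graph_functions V.
        \<forall>\<epsilon>>0. \<exists>F. finite F \<and> F \<subseteq> V \<and> (\<forall>v\<in>V - F. cmod (f v * \<mu> v) < \<epsilon>)}"

definition c0_norm :: "'v set \<Rightarrow> ('v \<Rightarrow> complex) \<Rightarrow> ('v \<Rightarrow> complex) \<Rightarrow> real" where
  "c0_norm V \<mu> f = (SUP v\<in>V. cmod (f v * \<mu> v))"

definition bounded_operator_on ::
    "('v \<Rightarrow> complex) set \<Rightarrow> (('v \<Rightarrow> complex) \<Rightarrow> real) \<Rightarrow>
     (('v \<Rightarrow> complex) \<Rightarrow> ('v \<Rightarrow> complex)) \<Rightarrow> bool" where
  "bounded_operator_on X N T \<longleftrightarrow>
     (\<forall>f\<in>X. T f \<in> X) \<and>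
     (\<forall>f\<in>X. \<forall>g\<in>X. \<forall>a b. T (\<lambda>v. a * f v + b * g v) = (\<lambda>v. a * T f v + b * T g v)) \<and>
     (\<exists>C. \<forall>f\<in>X. N (T f) \<le> C * N f)"

text \<open>
  The topology on \<open>X\<close> induced by the norm \<open>N\<close>. It is not defined through
  \<open>Metric_space.mtopology\<close> because that locale constrains the distance outside the carrier too,
  where \<^const>\<open>c0_norm\<close> may be the supremum of an unbounded set; the two agree by
  \<open>norm_topology_eq_mtopology\<close> whenever the locale applies.
\<close>

definition norm_topology ::
    "('v \<Rightarrow> complex) set \<Rightarrow> (('v \<Rightarrow> complex) \<Rightarrow> real) \<Rightarrow> ('v \<Rightarrow> complex) topology" where
  "norm_topology X N =
     topology (\<lambda>U. U \<subseteq> X \<and> (\<forall>f\<in>U. \<exists>r>0. {g \<in> X. N (\<lambda>v. f v - g v) < r} \<subseteq> U))"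

lemma openin_norm_topology:
  "openin (norm_topology X N) U \<longleftrightarrow>
     U \<subseteq> X \<and> (\<forall>f\<in>U. \<exists>r>0. {g \<in> X. N (\<lambda>v. f v - g v) < r} \<subseteq> U)"
proof -
  let ?P = "\<lambda>U. U \<subseteq> X \<and> (\<forall>f\<in>U. \<exists>r>0. {g \<in> X. N (\<lambda>v. f v - g v) < r} \<subseteq> U)"
  have "istopology ?P"
    unfolding istopology_def
  proof (intro conjI allI impI)
    fix S T assume S: "?P S" and T: "?P T"
    show "S \<inter> T \<subseteq> X" using S by blast
    show "\<forall>f\<in>S \<inter> T. \<exists>r>0. {g \<in> X. N (\<lambda>v. f v - g v) < r} \<subseteq> S \<inter> T"
    proof
      fix f assume f: "f \<in> S \<inter> T"
      obtain r where r: "r > 0" "{g \<in> X. N (\<lambda>v. f v - g v) < r} \<subseteq> S"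
        using S f by blast
      obtain s where s: "s > 0" "{g \<in> X. N (\<lambda>v. f v - g v) < s} \<subseteq> T"
        using T f by blast
      have "min r s > 0" "{g \<in> X. N (\<lambda>v. f v - g v) < min r s} \<subseteq> S \<inter> T"
        using r s by auto
      then show "\<exists>r>0. {g \<in> X. N (\<lambda>v. f v - g v) < r} \<subseteq> S \<inter> T" by blast
    qed
  next
    fix \<K> assume K: "\<forall>K\<in>\<K>. ?P K"
    show "\<Union>\<K> \<subseteq> X" using K by blast
    show "\<forall>f\<in>\<Union>\<K>. \<exists>r>0. {g \<in> X. N (\<lambda>v. f v - g v) < r} \<subseteq> \<Union>\<K>"
    proof
      fix f assume "f \<in> \<Union>\<K>"
      then obtain K where "K \<in> \<K>" "f \<in> K" by blast
      with K obtain r where "r > 0" "{g \<in> X. N (\<lambda>v. f v - g v) < r} \<subseteq> K" by blast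
      then show "\<exists>r>0. {g \<in> X. N (\<lambda>v. f v - g v) < r} \<subseteq> \<Union>\<K>"
        using \<open>K \<in> \<K>\<close> by blast
    qed
  qed
  then show ?thesis by (simp add: norm_topology_def)
qed

lemma topspace_norm_topology [simp]: "topspace (norm_topology X N) = X"
proof
  show "topspace (norm_topology X N) \<subseteq> X"
    using openin_norm_topology openin_topspace by blast
  have "openin (norm_topology X N) X"
    unfolding openin_norm_topology using zero_less_one by blast
  then show "X \<subseteq> topspace (norm_topology X N)" by (rule openin_subset)
qed

lemma norm_topology_eq_mtopology:
  assumes "Metric_space X (\<lambda>f g. N (\<lambda>v. f v - g v))"
  shows "norm_topology X N = Metric_space.mtopology X (\<lambda>f g. N (\<lambda>v. f v - g v))"
proof -
  interpret Metric_space X "\<lambda>f g. N (\<lambda>v. f v - g v)" by (rule assms)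
  have ball: "mball f r = {g \<in> X. N (\<lambda>v. f v - g v) < r}" if "f \<in> X" for f r
    using that by (auto simp: mball_def)
  have "openin (norm_topology X N) U = openin mtopology U" for U
  proof (cases "U \<subseteq> X")
    case True
    then have "(\<exists>r>0. mball f r \<subseteq> U) \<longleftrightarrow> (\<exists>r>0. {g \<in> X. N (\<lambda>v. f v - g v) < r} \<subseteq> U)"
      if "f \<in> U" for f
      using ball[of f] that by (simp add: subset_iff)
    then show ?thesis
      unfolding openin_norm_topology openin_mtopology Ball_def by (simp cong: imp_cong)
  qed (simp add: openin_norm_topology openin_mtopology)
  then show ?thesis by (simp add: topology_eq)
qed

definition hypercyclic_on :: "'a topology \<Rightarrow> ('a \<Rightarrow> 'a) \<Rightarrow> bool" where
  "hypercyclic_on \<T> T \<longleftrightarrow>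
     (\<exists>x\<in>topspace \<T>. \<T> closure_of (range (\<lambda>n::nat. (T ^^ n) x)) = topspace \<T>)"

definition weakly_mixing_on :: "'a topology \<Rightarrow> ('a \<Rightarrow> 'a) \<Rightarrow> bool" where
  "weakly_mixing_on \<T> T \<longleftrightarrow> hypercyclic_on (prod_topology \<T> \<T>) (map_prod T T)"

definition mixing_on :: "'a topology \<Rightarrow> ('a \<Rightarrow> 'a) \<Rightarrow> bool" where
  "mixing_on \<T> T \<longleftrightarrow>
     (\<forall>U W. openin \<T> U \<and> openin \<T> W \<and> U \<noteq> {} \<and> W \<noteq> {} \<longrightarrow>
        (\<exists>N::nat. \<forall>n\<ge>N. (T ^^ n) ` U \<inter> W \<noteq> {}))"

definition lattice_verts :: "(nat \<times> nat) set" where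
  "lattice_verts = {1..} \<times> {1..}"

definition lattice_edges :: "((nat \<times> nat) \<times> (nat \<times> nat)) set" where
  "lattice_edges =
     {((i, j), (i, j + 1)) | i j. i \<ge> 1 \<and> j \<ge> 1} \<union>
     {((i, j), (i + 1, j)) | i j. i \<ge> 1 \<and> j \<ge> 1}"

text \<open>The filter on the lattice vertices expressing \<open>i + j \<rightarrow> \<infinity>\<close>.\<close>

definition lattice_at_infinity :: "(nat \<times> nat) filter" where
  "lattice_at_infinity =
     inf (filtercomap (\<lambda>(i, j). i + j) at_top) (principal lattice_verts)"

end

theory Submission
  imports Defs
begin

text \<open>
  The functions \<open>(i, j) \<mapsto> z\<^sup>i (1 - z)\<^sup>j\<close> are fixed by the shift. Restricting them to a level
  \<open>i + j = m + n\<close> gives functions that \<open>B\<^sup>n\<close> maps to the corresponding restriction to level \<open>m\<close>,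
  and these restrictions span all functions on level \<open>m\<close> (Vandermonde) even if \<open>z\<close> varies only
  near \<open>1/2\<close>. Hence every finitely supported \<open>g\<close> is \<open>B\<^sup>n h\<^sub>n\<close> with \<open>|h\<^sub>n| \<le> K r\<^sup>i\<^sup>+\<^sup>j\<close> on levels at
  least \<open>n\<close>, where \<open>r > 1/2\<close> is arbitrary; if the weight grows at a rate \<open>q < 2\<close> then \<open>r q < 1\<close> is
  possible and \<open>h\<^sub>n\<close> tends to \<open>0\<close>. As \<open>B\<close> annihilates finitely supported functions eventually, this
  gives mixing, and a series of such \<open>h\<^sub>n\<close> with rapidly increasing \<open>n\<close> is a hypercyclic vector,
  simultaneously in two coordinates.

  If the weight is at least \<open>c 2\<^sup>i\<^sup>+\<^sup>j\<close>, then every \<open>f\<close> in the space is bounded by \<open>K 2\<^sup>-\<^sup>i\<^sup>-\<^sup>j\<close>, and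
  the shift preserves this bound, so that the values of an orbit at a vertex are bounded.
\<close>

section \<open>Weighted sequence spaces\<close>

lemma powr_convex_combination:
  fixes x y t p :: real
  assumes p: "p \<ge> 1" and x: "x \<ge> 0" and y: "y \<ge> 0" and t: "0 \<le> t" "t \<le> 1"
  shows "((1 - t) * x + t * y) powr p \<le> (1 - t) * x powr p + t * y powr p"
proof -
  \<comment> \<open>If one argument is 0, the claim reduces to this inequality, which rests on
    \<open>s powr p \<le> s\<close> for \<open>s\<close> in [0, 1]. The convexity of
    \<open>powr\<close> is applied only to positive arguments.\<close>
  have scale: "(s * z) powr p \<le> s * z powr p" if "0 \<le> s" "s \<le> 1" "z \<ge> 0" for s z :: real
  proof -
    have "s powr p \<le> s powr 1" using that p by (intro powr_mono') auto
    then show ?thesis using that by (simp add: powr_mult mult_right_mono)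
  qed
  show ?thesis
  proof (cases "x = 0 \<or> y = 0")
    case True
    then show ?thesis using scale[of t y] scale[of "1 - t" x] t x y p by auto
  next
    case False
    then show ?thesis
      using convex_onD[OF powr_convex[OF p], of t x y] x y t by simp
  qed
qed

text \<open>Convexity with the weights \<open>a / (a + b)\<close> and \<open>b / (a + b)\<close> at
  the points \<open>x / a\<close> and \<open>y / b\<close>, whose weighted mean is
  \<open>(x + y) / (a + b)\<close>. Later \<open>a\<close> and \<open>b\<close> lie just above the
  two norms.\<close>

lemma powr_add_le_weighted:
  fixes x y a b p :: real
  assumes p: "p \<ge> 1" and x: "x \<ge> 0" and y: "y \<ge> 0" and a: "a > 0" and b: "b > 0"
  shows "(x + y) powr p
    \<le> (a + b) powr p * (a / (a + b) * (x powr p / a powr p) + b / (a + b) * (y powr p / b powr p))"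
proof -
  define t where "t = b / (a + b)"
  have t: "0 \<le> t" "t \<le> 1" "1 - t = a / (a + b)"
    using a b by (auto simp: t_def field_simps)
  have "x + y = (a + b) * ((1 - t) * (x / a) + t * (y / b))"
  proof -
    have "(a + b) * (1 - t) = a" "(a + b) * t = b"
      unfolding t(3) using a b by (simp_all add: t_def)
    then show ?thesis
      using a b by (simp add: distrib_left mult.assoc[symmetric])
  qed
  then have "(x + y) powr p = (a + b) powr p * ((1 - t) * (x / a) + t * (y / b)) powr p"
    using a b x y t by (simp add: powr_mult)
  also have "\<dots> \<le> (a + b) powr p * ((1 - t) * (x / a) powr p + t * (y / b) powr p)"
    using powr_convex_combination[OF p, of "x / a" "y / b" t] a b x y t
    by (intro mult_left_mono) auto
  finally show ?thesis
    unfolding t(3) using a b x y by (simp only: powr_divide t_def less_imp_le)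
qed

text \<open>Summing the weighted pointwise inequality gives the bound \<open>(a + b) powr p\<close>
  whenever \<open>a\<close> and \<open>b\<close> exceed the two norms; letting them decrease to the
  norms yields the claim. Strict excess keeps both positive, which also covers vanishing
  norms.\<close>

lemma minkowski_infsum:
  fixes f g :: "'v \<Rightarrow> real"
  assumes p: "p \<ge> 1" and f0: "\<And>v. v \<in> V \<Longrightarrow> f v \<ge> 0" and g0: "\<And>v. v \<in> V \<Longrightarrow> g v \<ge> 0"
    and f: "(\<lambda>v. f v powr p) summable_on V" and g: "(\<lambda>v. g v powr p) summable_on V"
  shows "(\<lambda>v. (f v + g v) powr p) summable_on V"
    and "(\<Sum>\<^sub>\<infinity>v\<in>V. (f v + g v) powr p) powr (1 / p)
      \<le> (\<Sum>\<^sub>\<infinity>v\<in>V. f v powr p) powr (1 / p) + (\<Sum>\<^sub>\<infinity>v\<in>V. g v powr p) powr (1 / p)"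
proof -
  let ?F = "\<Sum>\<^sub>\<infinity>v\<in>V. f v powr p" and ?G = "\<Sum>\<^sub>\<infinity>v\<in>V. g v powr p"
  let ?H = "\<Sum>\<^sub>\<infinity>v\<in>V. (f v + g v) powr p"
  let ?w = "\<lambda>a b v. (a + b) powr p *
    (a / (a + b) * (f v powr p / a powr p) + b / (a + b) * (g v powr p / b powr p))"
  have w_eq: "?w a b = (\<lambda>v. (a + b) powr p * (a / (a + b) / a powr p) * f v powr p
      + (a + b) powr p * (b / (a + b) / b powr p) * g v powr p)" for a b
    by (auto simp: algebra_simps)
  have w: "?w a b summable_on V" for a b
    unfolding w_eq using f g by (intro summable_on_add summable_on_cmult_right)
  have le: "(f v + g v) powr p \<le> ?w a b v" if "v \<in> V" "a > 0" "b > 0" for a b v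
    using powr_add_le_weighted[OF p f0 g0] that by blast
  show sum: "(\<lambda>v. (f v + g v) powr p) summable_on V"
    by (rule summable_on_comparison_test[OF w[of 1 1]]) (use le[of _ 1 1] in auto)
  have F0: "?F \<ge> 0" and G0: "?G \<ge> 0" by (auto intro: infsum_nonneg)
  have bound: "?H powr (1 / p) \<le> a + b" if ab: "a > ?F powr (1 / p)" "b > ?G powr (1 / p)" for a b
  proof -
    have a: "a > 0" and b: "b > 0"
      using ab powr_ge_zero le_less_trans by blast+
    have Fa: "?F \<le> a powr p" and Gb: "?G \<le> b powr p"
      using powr_mono2[of p "?F powr (1 / p)" a] powr_mono2[of p "?G powr (1 / p)" b] ab p F0 G0
      by (auto simp: powr_powr)
    have "?H \<le> infsum (?w a b) V"
      using sum w le a b by (intro infsum_mono) auto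
    also have "\<dots> = (a + b) powr p * (a / (a + b) * (?F / a powr p) + b / (a + b) * (?G / b powr p))"
      unfolding w_eq infsum_add[OF summable_on_cmult_right[OF f] summable_on_cmult_right[OF g]]
        infsum_cmult_right' by (simp add: distrib_left)
    also have "\<dots> \<le> (a + b) powr p * (a / (a + b) * 1 + b / (a + b) * 1)"
      using a b Fa Gb by (intro mult_left_mono add_mono) auto
    also have "\<dots> = (a + b) powr p"
      using a b by (simp add: add_divide_distrib[symmetric])
    finally have "?H powr (1 / p) \<le> ((a + b) powr p) powr (1 / p)"
      using p by (intro powr_mono2) (auto intro: infsum_nonneg)
    then show ?thesis using p a b by (simp add: powr_powr)
  qed
  show "?H powr (1 / p) \<le> ?F powr (1 / p) + ?G powr (1 / p)"
  proof (rule field_le_epsilon)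
    fix e :: real assume "e > 0"
    then show "?H powr (1 / p) \<le> ?F powr (1 / p) + ?G powr (1 / p) + e"
      using bound[of "?F powr (1 / p) + e / 2" "?G powr (1 / p) + e / 2"] by simp
  qed
qed

text \<open>The interface through which both kinds of space are treated at once: control of
  coordinates (\<open>coord_le\<close>), a contractive embedding of the weighted l^1 space
  (\<open>l1_mem\<close>, \<open>l1_le\<close>) and approximation by finitely supported functions
  (\<open>finite_approx\<close>).\<close>

locale weighted_sequence_space =
  fixes V :: "'v set" and \<mu> :: "'v \<Rightarrow> complex"
    and X :: "('v \<Rightarrow> complex) set" and N :: "('v \<Rightarrow> complex) \<Rightarrow> real"
  assumes add_mem: "\<lbrakk>f \<in> X; g \<in> X\<rbrakk> \<Longrightarrow> (\<lambda>v. f v + g v) \<in> X"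
    and scale_mem: "f \<in> X \<Longrightarrow> (\<lambda>v. c * f v) \<in> X"
    and triangle: "\<lbrakk>f \<in> X; g \<in> X\<rbrakk> \<Longrightarrow> N (\<lambda>v. f v + g v) \<le> N f + N g"
    and diff_commute: "N (\<lambda>v. f v - g v) = N (\<lambda>v. g v - f v)"
    and coord_le: "\<lbrakk>f \<in> X; v \<in> V\<rbrakk> \<Longrightarrow> cmod (f v * \<mu> v) \<le> N f"
    and l1_mem: "\<lbrakk>f \<in> graph_functions V; (\<lambda>v. cmod (f v * \<mu> v)) summable_on V\<rbrakk> \<Longrightarrow> f \<in> X"
    and l1_le: "\<lbrakk>f \<in> graph_functions V; (\<lambda>v. cmod (f v * \<mu> v)) summable_on V\<rbrakk>
      \<Longrightarrow> N f \<le> (\<Sum>\<^sub>\<infinity>v\<in>V. cmod (f v * \<mu> v))"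
    and finite_approx: "\<lbrakk>f \<in> X; e > 0\<rbrakk>
      \<Longrightarrow> \<exists>F. finite F \<and> F \<subseteq> V \<and> N (\<lambda>v. if v \<in> F then 0 else f v) < e"

lemma weighted_sequence_space_lp:
  assumes p: "p \<ge> 1"
  shows "weighted_sequence_space V \<mu> (lp_space p V \<mu>) (lp_norm p V \<mu>)"
proof -
  note defs = lp_space_def lp_norm_def graph_functions_def
  have add: "(\<lambda>v. cmod ((f v + g v) * \<mu> v) powr p) summable_on V"
    "lp_norm p V \<mu> (\<lambda>v. f v + g v) \<le> lp_norm p V \<mu> f + lp_norm p V \<mu> g"
    if "f \<in> lp_space p V \<mu>" "g \<in> lp_space p V \<mu>" for f g
  proof -
    have s: "(\<lambda>v. cmod (f v * \<mu> v) powr p) summable_on V" "(\<lambda>v. cmod (g v * \<mu> v) powr p) summable_on V"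
      using that by (auto simp: defs)
    note M = minkowski_infsum[OF p _ _ s, simplified]
    have le: "cmod ((f v + g v) * \<mu> v) powr p \<le> (cmod (f v * \<mu> v) + cmod (g v * \<mu> v)) powr p" for v
      using p norm_triangle_ineq[of "f v * \<mu> v" "g v * \<mu> v"]
      by (intro powr_mono2) (auto simp: algebra_simps)
    show sum: "(\<lambda>v. cmod ((f v + g v) * \<mu> v) powr p) summable_on V"
      by (rule summable_on_comparison_test[OF M(1)]) (use le in auto)
    have "lp_norm p V \<mu> (\<lambda>v. f v + g v)
        \<le> (\<Sum>\<^sub>\<infinity>v\<in>V. (cmod (f v * \<mu> v) + cmod (g v * \<mu> v)) powr p) powr (1 / p)"
      unfolding lp_norm_def using p le sum M(1)
      by (intro powr_mono2 infsum_mono le) (auto intro: infsum_nonneg)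
    also have "\<dots> \<le> lp_norm p V \<mu> f + lp_norm p V \<mu> g"
      unfolding lp_norm_def by (rule M(2))
    finally show "lp_norm p V \<mu> (\<lambda>v. f v + g v) \<le> lp_norm p V \<mu> f + lp_norm p V \<mu> g" .
  qed
  \<comment> \<open>Every term \<open>t\<close> is at most the total \<open>S\<close>, so
    \<open>t powr p \<le> S powr (p - 1) * t\<close>; summation yields
    \<open>S powr p\<close>.\<close>
  have l1: "(\<lambda>v. cmod (f v * \<mu> v) powr p) summable_on V
      \<and> lp_norm p V \<mu> f \<le> (\<Sum>\<^sub>\<infinity>v\<in>V. cmod (f v * \<mu> v))"
    if f: "(\<lambda>v. cmod (f v * \<mu> v)) summable_on V" for f
  proof -
    define S where "S = (\<Sum>\<^sub>\<infinity>v\<in>V. cmod (f v * \<mu> v))"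
    have S0: "S \<ge> 0" unfolding S_def by (auto intro: infsum_nonneg)
    have le: "cmod (f v * \<mu> v) powr p \<le> S powr (p - 1) * cmod (f v * \<mu> v)" if "v \<in> V" for v
    proof -
      have "cmod (f v * \<mu> v) \<le> S"
        using finite_sum_le_infsum[OF f, of "{v}"] that by (simp add: S_def)
      then have "cmod (f v * \<mu> v) powr (p - 1) \<le> S powr (p - 1)"
        using p by (intro powr_mono2) auto
      then have "cmod (f v * \<mu> v) powr (p - 1) * cmod (f v * \<mu> v) \<le> S powr (p - 1) * cmod (f v * \<mu> v)"
        by (rule mult_right_mono) simp
      moreover have "cmod (f v * \<mu> v) powr (p - 1) * cmod (f v * \<mu> v) = cmod (f v * \<mu> v) powr p"
        by (cases "f v * \<mu> v = 0") (auto simp: powr_diff)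
      ultimately show ?thesis by linarith
    qed
    have sum: "(\<lambda>v. cmod (f v * \<mu> v) powr p) summable_on V"
      by (rule summable_on_comparison_test[OF summable_on_cmult_right[OF f]]) (use le in auto)
    have "(\<Sum>\<^sub>\<infinity>v\<in>V. cmod (f v * \<mu> v) powr p) \<le> (\<Sum>\<^sub>\<infinity>v\<in>V. S powr (p - 1) * cmod (f v * \<mu> v))"
      by (intro infsum_mono sum summable_on_cmult_right[OF f] le)
    also have "\<dots> = S powr (p - 1) * S" by (simp add: infsum_cmult_right' S_def)
    also have "\<dots> = S powr p" using S0 by (cases "S = 0") (auto simp: powr_diff)
    finally have "lp_norm p V \<mu> f \<le> (S powr p) powr (1 / p)"
      unfolding lp_norm_def using p by (intro powr_mono2) (auto intro: infsum_nonneg)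
    then show ?thesis using sum S0 p by (simp add: powr_powr S_def)
  qed
  show ?thesis
  proof
    fix f g assume "f \<in> lp_space p V \<mu>" "g \<in> lp_space p V \<mu>"
    then show "(\<lambda>v. f v + g v) \<in> lp_space p V \<mu>"
      using add(1) by (auto simp: defs)
  next
    fix f c assume "f \<in> lp_space p V \<mu>"
    then show "(\<lambda>v. c * f v) \<in> lp_space p V \<mu>"
      by (auto simp: defs norm_mult powr_mult mult.assoc intro!: summable_on_cmult_right)
  next
    fix f g assume "f \<in> lp_space p V \<mu>" "g \<in> lp_space p V \<mu>"
    then show "lp_norm p V \<mu> (\<lambda>v. f v + g v) \<le> lp_norm p V \<mu> f + lp_norm p V \<mu> g"
      by (rule add(2))
  next
    fix f g show "lp_norm p V \<mu> (\<lambda>v. f v - g v) = lp_norm p V \<mu> (\<lambda>v. g v - f v)"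
      by (simp add: lp_norm_def norm_mult norm_minus_commute)
  next
    fix f v assume f: "f \<in> lp_space p V \<mu>" and v: "v \<in> V"
    have "cmod (f v * \<mu> v) powr p \<le> (\<Sum>\<^sub>\<infinity>v\<in>V. cmod (f v * \<mu> v) powr p)"
      using finite_sum_le_infsum[of "\<lambda>v. cmod (f v * \<mu> v) powr p" V "{v}"] f v by (auto simp: defs)
    then have "(cmod (f v * \<mu> v) powr p) powr (1 / p) \<le> lp_norm p V \<mu> f"
      unfolding lp_norm_def using p by (intro powr_mono2) auto
    then show "cmod (f v * \<mu> v) \<le> lp_norm p V \<mu> f" using p by (simp add: powr_powr)
  next
    fix f assume "f \<in> graph_functions V" "(\<lambda>v. cmod (f v * \<mu> v)) summable_on V"
    then show "f \<in> lp_space p V \<mu>" "lp_norm p V \<mu> f \<le> (\<Sum>\<^sub>\<infinity>v\<in>V. cmod (f v * \<mu> v))"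
      using l1[of f] by (auto simp: lp_space_def)
  next
    fix f and e :: real assume f: "f \<in> lp_space p V \<mu>" and e: "e > 0"
    let ?h = "\<lambda>v. cmod (f v * \<mu> v) powr p"
    have sum: "?h summable_on V" using f by (auto simp: defs)
    \<comment> \<open>The finite approximation is only a weak inequality; aiming at
      \<open>e / 2\<close> leaves the final norm strictly below \<open>e\<close>.\<close>
    have "(e / 2) powr p > 0" using e by simp
    then obtain F where F: "finite F" "F \<subseteq> V" "dist (sum ?h F) (infsum ?h V) \<le> (e / 2) powr p"
      using infsum_finite_approximation[OF sum] by blast
    have "(\<Sum>\<^sub>\<infinity>v\<in>V. cmod ((if v \<in> F then 0 else f v) * \<mu> v) powr p) = infsum ?h (V - F)"
      by (intro infsum_cong_neutral) auto
    also have "\<dots> = infsum ?h V - sum ?h F"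
      using infsum_Diff[OF sum, of F] F by (simp add: summable_on_finite)
    also have "\<dots> \<le> (e / 2) powr p" using F(3) by (simp add: dist_real_def)
    finally have "lp_norm p V \<mu> (\<lambda>v. if v \<in> F then 0 else f v) \<le> ((e / 2) powr p) powr (1 / p)"
      unfolding lp_norm_def using p by (intro powr_mono2) (auto intro: infsum_nonneg)
    then have "lp_norm p V \<mu> (\<lambda>v. if v \<in> F then 0 else f v) < e"
      using e p by (simp add: powr_powr)
    then show "\<exists>F. finite F \<and> F \<subseteq> V \<and> lp_norm p V \<mu> (\<lambda>v. if v \<in> F then 0 else f v) < e"
      using F by blast
  qed
qed

text \<open>The points with weighted value at least \<open>e\<close> lie in every admissible
  exceptional set and form one themselves when there are finitely many of them.\<close>

lemma mem_c0_space_iff: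
  "f \<in> c0_space V \<mu> \<longleftrightarrow>
    f \<in> graph_functions V \<and> (\<forall>e>0. finite {v \<in> V. cmod (f v * \<mu> v) \<ge> e})"
proof -
  have "(\<exists>F. finite F \<and> F \<subseteq> V \<and> (\<forall>v\<in>V - F. cmod (f v * \<mu> v) < e)) \<longleftrightarrow>
      finite {v \<in> V. cmod (f v * \<mu> v) \<ge> e}" (is "?L \<longleftrightarrow> ?R") for e
  proof
    assume ?L
    then obtain F where F: "finite F" "\<forall>v\<in>V - F. cmod (f v * \<mu> v) < e" by blast
    show ?R by (rule finite_subset[OF _ F(1)]) (use F(2) in force)
  next
    assume ?R
    then show ?L by (intro exI[of _ "{v \<in> V. cmod (f v * \<mu> v) \<ge> e}"]) auto
  qed
  then show ?thesis by (simp add: c0_space_def)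
qed

text \<open>The norm is a real supremum, meaningful only for a nonempty bounded set:
  \<open>V \<noteq> {}\<close> provides the first property and \<open>bdd\<close> the
  second.\<close>

lemma weighted_sequence_space_c0:
  assumes V: "V \<noteq> {}"
  shows "weighted_sequence_space V \<mu> (c0_space V \<mu>) (c0_norm V \<mu>)"
proof -
  have bdd: "bdd_above ((\<lambda>v. cmod (f v * \<mu> v)) ` V)" if "f \<in> c0_space V \<mu>" for f
  proof -
    have fin: "finite {v \<in> V. cmod (f v * \<mu> v) \<ge> 1}"
      using that by (auto simp: mem_c0_space_iff)
    have "cmod (f v * \<mu> v) \<le> 1 + (\<Sum>u\<in>{v \<in> V. cmod (f v * \<mu> v) \<ge> 1}. cmod (f u * \<mu> u))"
      if "v \<in> V" for v
    proof (cases "cmod (f v * \<mu> v) \<ge> 1")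
      case True
      then show ?thesis
        using member_le_sum[of v _ "\<lambda>u. cmod (f u * \<mu> u)", OF _ _ fin] that
        by (intro add_increasing) auto
    next
      case False
      moreover have "0 \<le> (\<Sum>u\<in>{v \<in> V. cmod (f v * \<mu> v) \<ge> 1}. cmod (f u * \<mu> u))"
        by (rule sum_nonneg) simp
      ultimately show ?thesis by linarith
    qed
    then show ?thesis by (rule bdd_aboveI2)
  qed
  have coord: "cmod (f v * \<mu> v) \<le> c0_norm V \<mu> f" if "f \<in> c0_space V \<mu>" "v \<in> V" for f v
    unfolding c0_norm_def by (rule cSUP_upper[OF that(2) bdd[OF that(1)]])
  have add_le: "cmod ((f v + g v) * \<mu> v) \<le> cmod (f v * \<mu> v) + cmod (g v * \<mu> v)" for f g v
    using norm_triangle_ineq[of "f v * \<mu> v" "g v * \<mu> v"] by (simp add: algebra_simps)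
  show ?thesis
  proof
    fix f g assume f: "f \<in> c0_space V \<mu>" and g: "g \<in> c0_space V \<mu>"
    have "finite {v \<in> V. cmod ((f v + g v) * \<mu> v) \<ge> e}" if "e > 0" for e
    proof (rule finite_subset)
      show "{v \<in> V. cmod ((f v + g v) * \<mu> v) \<ge> e}
          \<subseteq> {v \<in> V. cmod (f v * \<mu> v) \<ge> e / 2} \<union> {v \<in> V. cmod (g v * \<mu> v) \<ge> e / 2}"
      proof
        fix v assume "v \<in> {v \<in> V. cmod ((f v + g v) * \<mu> v) \<ge> e}"
        then show "v \<in> {v \<in> V. cmod (f v * \<mu> v) \<ge> e / 2} \<union> {v \<in> V. cmod (g v * \<mu> v) \<ge> e / 2}"
          using add_le[of f v g] by auto
      qed
      show "finite ({v \<in> V. cmod (f v * \<mu> v) \<ge> e / 2} \<union> {v \<in> V. cmod (g v * \<mu> v) \<ge> e / 2})"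
        using f g half_gt_zero[OF that] unfolding mem_c0_space_iff by blast
    qed
    then show "(\<lambda>v. f v + g v) \<in> c0_space V \<mu>"
      using f g by (auto simp: mem_c0_space_iff graph_functions_def)
    show "c0_norm V \<mu> (\<lambda>v. f v + g v) \<le> c0_norm V \<mu> f + c0_norm V \<mu> g"
      unfolding c0_norm_def[of _ _ "\<lambda>v. f v + g v"]
      by (rule cSUP_least[OF V]) (rule order_trans[OF add_le add_mono[OF coord[OF f] coord[OF g]]])
  next
    fix f c assume f: "f \<in> c0_space V \<mu>"
    have "finite {v \<in> V. cmod (c * f v * \<mu> v) \<ge> e}" if e: "e > 0" for e
    proof (cases "c = 0")
      case True
      then show ?thesis using e by simp
    next
      case False
      then have "{v \<in> V. cmod (c * f v * \<mu> v) \<ge> e} = {v \<in> V. cmod (f v * \<mu> v) \<ge> e / cmod c}"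
        by (auto simp: norm_mult field_simps)
      then show ?thesis using f False e by (simp add: mem_c0_space_iff)
    qed
    then show "(\<lambda>v. c * f v) \<in> c0_space V \<mu>"
      using f by (auto simp: mem_c0_space_iff graph_functions_def)
  next
    fix f g show "c0_norm V \<mu> (\<lambda>v. f v - g v) = c0_norm V \<mu> (\<lambda>v. g v - f v)"
      by (simp add: c0_norm_def norm_mult norm_minus_commute)
  next
    fix f v assume "f \<in> c0_space V \<mu>" "v \<in> V"
    then show "cmod (f v * \<mu> v) \<le> c0_norm V \<mu> f" by (rule coord)
  next
    fix f assume f: "f \<in> graph_functions V" and sum: "(\<lambda>v. cmod (f v * \<mu> v)) summable_on V"
    have le: "(\<Sum>v\<in>G. cmod (f v * \<mu> v)) \<le> (\<Sum>\<^sub>\<infinity>v\<in>V. cmod (f v * \<mu> v))" if "finite G" "G \<subseteq> V" for G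
      using that by (intro finite_sum_le_infsum[OF sum]) auto
    have "finite {v \<in> V. cmod (f v * \<mu> v) \<ge> e}" if e: "e > 0" for e
    proof -
      \<comment> \<open>Markov's inequality: each point of \<open>G\<close> contributes at least
        \<open>e\<close> to a finite total. A uniform bound on the cardinality of finite subsets
        forces the whole set to be finite.\<close>
      have "card G \<le> nat \<lceil>(\<Sum>\<^sub>\<infinity>v\<in>V. cmod (f v * \<mu> v)) / e\<rceil>"
        if "G \<subseteq> {v \<in> V. cmod (f v * \<mu> v) \<ge> e}" "finite G" for G
      proof -
        have "real (card G) * e \<le> (\<Sum>v\<in>G. cmod (f v * \<mu> v))"
          using sum_mono[of G "\<lambda>_. e" "\<lambda>v. cmod (f v * \<mu> v)"] that by auto
        also have "\<dots> \<le> (\<Sum>\<^sub>\<infinity>v\<in>V. cmod (f v * \<mu> v))" using that by (intro le) auto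
        finally have "real (card G) \<le> (\<Sum>\<^sub>\<infinity>v\<in>V. cmod (f v * \<mu> v)) / e"
          using e by (simp add: field_simps)
        then show ?thesis by linarith
      qed
      then show ?thesis using finite_if_finite_subsets_card_bdd by blast
    qed
    then show "f \<in> c0_space V \<mu>" using f by (simp add: mem_c0_space_iff)
    show "c0_norm V \<mu> f \<le> (\<Sum>\<^sub>\<infinity>v\<in>V. cmod (f v * \<mu> v))"
      unfolding c0_norm_def by (rule cSUP_least[OF V]) (use le[of "{v}" for v] in auto)
  next
    fix f and e :: real assume f: "f \<in> c0_space V \<mu>" and e: "e > 0"
    let ?F = "{v \<in> V. cmod (f v * \<mu> v) \<ge> e / 2}"
    have "c0_norm V \<mu> (\<lambda>v. if v \<in> ?F then 0 else f v) \<le> e / 2"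
      unfolding c0_norm_def by (rule cSUP_least[OF V]) (use e in auto)
    moreover have "finite ?F" using f half_gt_zero[OF e] unfolding mem_c0_space_iff by blast
    ultimately show "\<exists>F. finite F \<and> F \<subseteq> V \<and> c0_norm V \<mu> (\<lambda>v. if v \<in> F then 0 else f v) < e"
      using e by (intro exI[of _ ?F]) auto
  qed
qed

section \<open>Right inverses of the powers of the lattice shift\<close>

text \<open>Taking the coefficient of x^a is a linear functional on polynomials of degree below
  \<open>card W\<close>, hence a combination of evaluations at the nodes; \<open>c w\<close> is that
  coefficient of the Lagrange basis polynomial at \<open>w\<close>.\<close>

lemma vandermonde_coefficients:
  fixes W :: "'a::field set"
  assumes W: "finite W"
  obtains c where "\<And>i. i < card W \<Longrightarrow> (\<Sum>w\<in>W. c w * w ^ i) = (if i = a then 1 else 0)"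
proof
  define L where "L w = smult (inverse (\<Prod>u\<in>W - {w}. w - u)) (\<Prod>u\<in>W - {w}. [:- u, 1:])" for w :: 'a
  have L: "poly (L w) x = (if x = w then 1 else 0)" if "w \<in> W" "x \<in> W" for w x
    using that W by (auto simp: L_def poly_prod prod_zero_iff)
  have deg_L: "degree (L w) < card W" if "w \<in> W" for w
  proof -
    have "degree (\<Prod>u\<in>W - {w}. [:- u, 1:]) \<le> (\<Sum>u\<in>W - {w}. degree [:- u, 1:])"
      using degree_prod_sum_le[of "W - {w}" "\<lambda>u. [:- u, 1:]"] W by (simp add: o_def)
    also have "\<dots> = card W - 1" using W that by simp
    also have "\<dots> < card W" using card_gt_0_iff[of W] W that by auto
    finally show ?thesis by (simp add: L_def)
  qed
  fix i assume i: "i < card W"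
  have deg: "degree (\<Sum>w\<in>W. smult (w ^ i) (L w)) < card W"
    using deg_L W i by (intro degree_sum_less) (auto intro: le_less_trans[OF degree_smult_le])
  \<comment> \<open>Lagrange interpolation of \<open>x\<^sup>i\<close> at the nodes \<open>W\<close>; compare the coefficients of \<open>x\<^sup>a\<close>.\<close>
  have "(\<Sum>w\<in>W. smult (w ^ i) (L w)) = monom 1 i"
  proof (rule poly_eqI_degree[of W])
    fix x assume "x \<in> W"
    then show "poly (\<Sum>w\<in>W. smult (w ^ i) (L w)) x = poly (monom 1 i) x"
      using W by (simp add: poly_sum L poly_monom sum.delta if_distrib cong: if_cong)
  qed (use deg i in \<open>auto simp: degree_monom_eq\<close>)
  then have "coeff (\<Sum>w\<in>W. smult (w ^ i) (L w)) a = coeff (monom 1 i) a" by simp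
  then show "(\<Sum>w\<in>W. coeff (L w) a * w ^ i) = (if i = a then 1 else 0)"
    by (simp add: coeff_sum mult.commute)
qed

section \<open>The lattice shift, its iterates and its preimages\<close>

abbreviation (input) lattice_shift :: "(nat \<times> nat \<Rightarrow> complex) \<Rightarrow> (nat \<times> nat \<Rightarrow> complex)" where
  "lattice_shift \<equiv> backward_shift lattice_verts lattice_edges"

definition level :: "nat \<times> nat \<Rightarrow> nat" where
  "level v = fst v + snd v"

lemma mem_lattice_verts_iff: "(i, j) \<in> lattice_verts \<longleftrightarrow> i \<ge> 1 \<and> j \<ge> 1"
  by (simp add: lattice_verts_def)

lemma lattice_shift_apply:
  "lattice_shift f (i, j) = (if i \<ge> 1 \<and> j \<ge> 1 then f (i, Suc j) + f (Suc i, j) else 0)"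
proof -
  have "children lattice_edges (i, j) = {(i, Suc j), (Suc i, j)}" if "i \<ge> 1" "j \<ge> 1"
    using that by (auto simp: children_def lattice_edges_def)
  then show ?thesis by (simp add: backward_shift_def mem_lattice_verts_iff)
qed

lemma lattice_shift_sum:
  "lattice_shift (\<lambda>v. \<Sum>k\<in>K. c k * f k v) = (\<lambda>v. \<Sum>k\<in>K. c k * lattice_shift (f k) v)"
  by (auto simp: fun_eq_iff lattice_shift_apply sum.distrib distrib_left)

lemma lattice_shift_iter_add:
  "(lattice_shift ^^ n) (\<lambda>v. f v + g v) = (\<lambda>v. (lattice_shift ^^ n) f v + (lattice_shift ^^ n) g v)"
proof (induction n)
  case (Suc n)
  then show ?case by (auto simp: fun_eq_iff lattice_shift_apply)
qed simp

lemma lattice_shift_iter_scale: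
  "(lattice_shift ^^ n) (\<lambda>v. c * f v) = (\<lambda>v. c * (lattice_shift ^^ n) f v)"
proof (induction n)
  case (Suc n)
  then show ?case by (auto simp: fun_eq_iff lattice_shift_apply distrib_left)
qed simp

text \<open>Both children of a vertex lie one level higher, so each application lowers the level
  bound on the support by one; the induction trades a step of \<open>n\<close> for a step of
  \<open>m\<close>.\<close>

lemma lattice_shift_iter_eq_0:
  assumes "\<And>v. v \<in> lattice_verts \<Longrightarrow> level v \<ge> m + n \<Longrightarrow> f v = 0"
    and "v \<in> lattice_verts" "level v \<ge> m"
  shows "(lattice_shift ^^ n) f v = 0"
  using assms
proof (induction n arbitrary: m v)
  case (Suc n)
  obtain i j where v: "v = (i, j)" by (cases v)
  have "(lattice_shift ^^ n) f u = 0" if "u \<in> {(i, Suc j), (Suc i, j)}" for u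
    using that Suc.prems(2,3) by (intro Suc.IH[of "Suc m"] Suc.prems(1))
      (auto simp: v level_def mem_lattice_verts_iff)
  then show ?case by (simp add: v lattice_shift_apply)
qed simp

lemma lattice_shift_iter_graph_functions:
  assumes "f \<in> graph_functions lattice_verts"
  shows "(lattice_shift ^^ n) f \<in> graph_functions lattice_verts"
  using assms by (cases n) (auto simp: graph_functions_def backward_shift_def)

lemma lattice_shift_iter_vanishes:
  assumes "f \<in> graph_functions lattice_verts"
    and "\<And>v. v \<in> lattice_verts \<Longrightarrow> level v \<ge> n \<Longrightarrow> f v = 0"
  shows "(lattice_shift ^^ n) f = (\<lambda>_. 0)"
proof
  fix v
  show "(lattice_shift ^^ n) f v = 0"
  proof (cases "v \<in> lattice_verts")
    case True
    show ?thesis by (rule lattice_shift_iter_eq_0[of 0]) (use assms(2) True in auto)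
  next
    case False
    then show ?thesis
      using lattice_shift_iter_graph_functions[OF assms(1), of n] unfolding graph_functions_def by blast
  qed
qed

text \<open>
  Since \<open>z + (1 - z) = 1\<close>, the function \<open>(i, j) \<mapsto> z\<^sup>i (1 - z)\<^sup>j\<close> is fixed by the shift, so its
  restriction to a level is the image of its restriction to the next one.
\<close>

definition level_fun :: "complex \<Rightarrow> nat \<Rightarrow> nat \<times> nat \<Rightarrow> complex" where
  "level_fun z s v = (if v \<in> lattice_verts \<and> level v = s then z ^ fst v * (1 - z) ^ snd v else 0)"

lemma lattice_shift_level_fun: "lattice_shift (level_fun z (Suc s)) = level_fun z s"
  by (auto simp: fun_eq_iff level_fun_def lattice_shift_apply mem_lattice_verts_iff level_def algebra_simps)

lemma lattice_shift_iter_level_fun: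
  "(lattice_shift ^^ n) (\<lambda>v. \<Sum>z\<in>Z. c z * level_fun z (s + n) v) = (\<lambda>v. \<Sum>z\<in>Z. c z * level_fun z s v)"
proof (induction n arbitrary: s)
  case (Suc n)
  have "(lattice_shift ^^ Suc n) (\<lambda>v. \<Sum>z\<in>Z. c z * level_fun z (s + Suc n) v)
      = lattice_shift ((lattice_shift ^^ n) (\<lambda>v. \<Sum>z\<in>Z. c z * level_fun z (Suc s + n) v))"
    by simp
  also have "\<dots> = (\<lambda>v. \<Sum>z\<in>Z. c z * level_fun z s v)"
    by (simp only: Suc.IH lattice_shift_sum lattice_shift_level_fun)
  finally show ?case .
qed simp

definition delta :: "'v \<Rightarrow> 'v \<Rightarrow> complex" where
  "delta w v = (if v = w then 1 else 0)"

text \<open>On level \<open>s\<close> the function \<open>level_fun z s\<close> equals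
  \<open>(1 - z) ^ s\<close> times the power \<open>h z ^ fst v\<close> with
  \<open>h z = z / (1 - z)\<close>, so the expansion of \<open>delta w\<close> is a Vandermonde
  system in the nodes \<open>h z\<close>.\<close>

lemma delta_eq_sum_level_fun:
  assumes r: "r > 1 / 2" and w: "w \<in> lattice_verts"
  obtains Z c where "finite Z" "\<And>z. z \<in> Z \<Longrightarrow> cmod z \<le> r \<and> cmod (1 - z) \<le> r"
    "delta w = (\<lambda>v. \<Sum>z\<in>Z. c z * level_fun z (level w) v)"
proof -
  \<comment> \<open>The cap 3/4 keeps \<open>z\<close> away from 1, so that \<open>h\<close> is
    defined and injective. Nodes above 1/2 satisfy \<open>1 - z < 1/2 < r\<close>.\<close>
  define r' where "r' = min r (3 / 4)"
  define S where "S = (complex_of_real) ` {1 / 2<..<r'}"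
  have "infinite S"
    unfolding S_def using r
    by (subst finite_image_iff) (auto simp: inj_on_def r'_def infinite_Ioo)
  \<comment> \<open>On the level of \<open>w\<close> the exponent \<open>fst v\<close> is below
    \<open>level w\<close>, since \<open>snd v \<ge> 1\<close>; thus \<open>level w\<close> nodes
    suffice.\<close>
  then obtain Z where Z: "Z \<subseteq> S" "finite Z" "card Z = level w"
    using infinite_arbitrarily_large by blast
  have zr: "cmod z \<le> r \<and> cmod (1 - z) \<le> r \<and> z \<noteq> 1" if "z \<in> Z" for z
  proof -
    obtain x where x: "z = of_real x" "1 / 2 < x" "x < r'"
      using subsetD[OF Z(1) \<open>z \<in> Z\<close>] by (auto simp: S_def)
    have "1 - z = of_real (1 - x)" by (simp add: x)
    then show ?thesis using x by (auto simp: r'_def simp del: of_real_diff)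
  qed
  define h :: "complex \<Rightarrow> complex" where "h z = z / (1 - z)" for z
  have inj: "inj_on h Z"
    using zr by (auto simp: inj_on_def h_def field_simps)
  obtain c where c: "\<And>i. i < card (h ` Z) \<Longrightarrow> (\<Sum>u\<in>h ` Z. c u * u ^ i) = (if i = fst w then 1 else 0)"
    using vandermonde_coefficients[of "h ` Z" "fst w"] Z by auto
  have "delta w v = (\<Sum>z\<in>Z. (c (h z) / (1 - z) ^ level w) * level_fun z (level w) v)" for v
  proof (cases "v \<in> lattice_verts \<and> level v = level w")
    case True
    then have "fst v < level w"
      by (auto simp: level_def lattice_verts_def)
    then have "(\<Sum>z\<in>Z. c (h z) * h z ^ fst v) = (if fst v = fst w then 1 else 0)"
      using c[of "fst v"] inj Z by (simp add: card_image sum.reindex)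
    moreover have "c (h z) * h z ^ fst v = (c (h z) / (1 - z) ^ level w) * level_fun z (level w) v"
      if "z \<in> Z" for z
    proof -
      have "(1 - z) ^ level w = (1 - z) ^ fst v * (1 - z) ^ snd v"
        using True by (simp add: level_def power_add[symmetric])
      then show ?thesis using zr[OF that] True by (simp add: h_def level_fun_def power_divide)
    qed
    moreover have "v = w \<longleftrightarrow> fst v = fst w" using True by (auto simp: level_def prod_eq_iff)
    ultimately show ?thesis by (simp add: delta_def)
  next
    case False
    then show ?thesis using w by (auto simp: delta_def level_fun_def)
  qed
  then show thesis using that[of Z "\<lambda>z. c (h z) / (1 - z) ^ level w"] Z zr by blast
qed

text \<open>\<open>L\<close> and \<open>K\<close> are chosen before \<open>n\<close>, so the
  estimates are uniform in \<open>n\<close>. The lower end of the level window makes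
  \<open>h n\<close> small for large \<open>n\<close>, the upper end makes a later power of the
  shift annihilate it.\<close>

definition has_right_inverse :: "real \<Rightarrow> (nat \<times> nat \<Rightarrow> complex) \<Rightarrow> bool" where
  "has_right_inverse r g \<longleftrightarrow> (\<exists>h L K. \<forall>n.
     (lattice_shift ^^ n) (h n) = g \<and> h n \<in> graph_functions lattice_verts \<and>
     (\<forall>v\<in>lattice_verts. cmod (h n v) \<le> K * r ^ level v) \<and>
     (\<forall>v\<in>lattice_verts. h n v \<noteq> 0 \<longrightarrow> n \<le> level v \<and> level v < n + L))"

text \<open>The coefficients of \<open>delta w\<close> are reused on level
  \<open>level w + n\<close>, which the \<open>n\<close>-th power of the shift carries back to level
  \<open>level w\<close>. The half-open window requires \<open>L = Suc (level w)\<close>.\<close>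

lemma has_right_inverse_delta:
  assumes r: "r > 1 / 2" and w: "w \<in> lattice_verts"
  shows "has_right_inverse r (delta w)"
proof -
  obtain Z c where Z: "finite Z" "\<And>z. z \<in> Z \<Longrightarrow> cmod z \<le> r \<and> cmod (1 - z) \<le> r"
    and delta: "delta w = (\<lambda>v. \<Sum>z\<in>Z. c z * level_fun z (level w) v)"
    using delta_eq_sum_level_fun[OF r w] by blast
  define h where "h n = (\<lambda>v. \<Sum>z\<in>Z. c z * level_fun z (level w + n) v)" for n
  have "cmod (h n v) \<le> (\<Sum>z\<in>Z. cmod (c z)) * r ^ level v" for n v
  proof -
    have "cmod (level_fun z (level w + n) v) \<le> r ^ level v" if "z \<in> Z" for z
    proof -
      have "cmod (z ^ fst v * (1 - z) ^ snd v) \<le> r ^ fst v * r ^ snd v"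
        unfolding norm_mult norm_power using Z(2)[OF that] r by (intro mult_mono power_mono) auto
      then show ?thesis using r by (simp add: level_fun_def level_def power_add)
    qed
    then show ?thesis
      unfolding h_def sum_distrib_right
      by (intro order_trans[OF norm_sum] sum_mono) (simp add: norm_mult mult_left_mono)
  qed
  moreover have "(lattice_shift ^^ n) (h n) = delta w" for n
    unfolding h_def delta by (rule lattice_shift_iter_level_fun)
  moreover have "h n \<in> graph_functions lattice_verts" for n
    by (auto simp: h_def graph_functions_def level_fun_def)
  moreover have "level v = level w + n" if "h n v \<noteq> 0" for n v
  proof (rule ccontr)
    assume "level v \<noteq> level w + n"
    then have "h n v = 0" by (simp add: h_def level_fun_def)
    then show False using that by contradiction
  qed
  ultimately show ?thesis
    unfolding has_right_inverse_def
    by (intro exI[of _ h] exI[of _ "Suc (level w)"] exI[of _ "\<Sum>z\<in>Z. cmod (c z)"]) force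
qed

lemma has_right_inverse_add_scale:
  assumes r: "r \<ge> 0" and "has_right_inverse r f" "has_right_inverse r g"
  shows "has_right_inverse r (\<lambda>v. f v + c * g v)"
proof -
  obtain h L K where h: "\<And>n. (lattice_shift ^^ n) (h n) = f" "\<And>n. h n \<in> graph_functions lattice_verts"
    "\<And>n v. v \<in> lattice_verts \<Longrightarrow> cmod (h n v) \<le> K * r ^ level v"
    "\<And>n v. v \<in> lattice_verts \<Longrightarrow> h n v \<noteq> 0 \<Longrightarrow> n \<le> level v \<and> level v < n + L"
    using assms(2) unfolding has_right_inverse_def by blast
  obtain h' L' K' where h': "\<And>n. (lattice_shift ^^ n) (h' n) = g" "\<And>n. h' n \<in> graph_functions lattice_verts"
    "\<And>n v. v \<in> lattice_verts \<Longrightarrow> cmod (h' n v) \<le> K' * r ^ level v"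
    "\<And>n v. v \<in> lattice_verts \<Longrightarrow> h' n v \<noteq> 0 \<Longrightarrow> n \<le> level v \<and> level v < n + L'"
    using assms(3) unfolding has_right_inverse_def by blast
  define k where "k n = (\<lambda>v. h n v + c * h' n v)" for n
  have "cmod (k n v) \<le> (K + cmod c * K') * r ^ level v" if "v \<in> lattice_verts" for n v
  proof -
    have "cmod (k n v) \<le> cmod (h n v) + cmod c * cmod (h' n v)"
      unfolding k_def norm_mult[symmetric] by (rule norm_triangle_ineq)
    also have "\<dots> \<le> K * r ^ level v + cmod c * (K' * r ^ level v)"
      using that by (intro add_mono mult_left_mono h h') auto
    finally show ?thesis by (simp add: algebra_simps)
  qed
  moreover have "(lattice_shift ^^ n) (k n) = (\<lambda>v. f v + c * g v)" for n
    unfolding k_def lattice_shift_iter_add lattice_shift_iter_scale h(1) h'(1) ..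
  moreover have "k n \<in> graph_functions lattice_verts" for n
    using h(2)[of n] h'(2)[of n] by (auto simp: k_def graph_functions_def)
  moreover have "n \<le> level v \<and> level v < n + max L L'" if "v \<in> lattice_verts" "k n v \<noteq> 0" for n v
  proof -
    have "h n v \<noteq> 0 \<or> h' n v \<noteq> 0" using that by (auto simp: k_def)
    then show ?thesis using h(4)[OF that(1), of n] h'(4)[OF that(1), of n] by linarith
  qed
  ultimately show ?thesis
    unfolding has_right_inverse_def
    by (intro exI[of _ k] exI[of _ "max L L'"] exI[of _ "K + cmod c * K'"]) blast
qed

lemma has_right_inverse_finite_support:
  assumes r: "r > 1 / 2" and F: "finite F" "F \<subseteq> lattice_verts" and g: "\<And>v. v \<notin> F \<Longrightarrow> g v = 0"
  shows "has_right_inverse r g"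
  using F g
proof (induction F arbitrary: g rule: finite_induct)
  case empty
  then have "g = (\<lambda>_. 0)" by auto
  moreover have "(lattice_shift ^^ n) (\<lambda>_. 0) = (\<lambda>_. 0)" for n
    using lattice_shift_iter_scale[of n 0] by simp
  ultimately show ?case
    unfolding has_right_inverse_def
    by (intro exI[of _ "\<lambda>_ _. 0"] exI[of _ 0]) (auto simp: graph_functions_def)
next
  case (insert w F)
  have "has_right_inverse r (g(w := 0))"
    using insert by (intro insert.IH) auto
  moreover have "has_right_inverse r (delta w)"
    using insert.prems by (intro has_right_inverse_delta[OF r]) auto
  ultimately have "has_right_inverse r (\<lambda>v. (g(w := 0)) v + g w * delta w v)"
    by (rule has_right_inverse_add_scale[rotated]) (use r in simp)
  also have "(\<lambda>v. (g(w := 0)) v + g w * delta w v) = g"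
    by (auto simp: delta_def)
  finally show ?case .
qed

section \<open>Summability over the lattice and growth of the weight\<close>

lemma summable_on_power_level:
  fixes s :: real
  assumes "0 \<le> s" "s < 1"
  shows "(\<lambda>v. s ^ level v) summable_on lattice_verts"
proof -
  have s: "(\<lambda>i. s ^ i) summable_on {1..}"
    using assms summable_geometric[of s]
    by (intro summable_on_subset[OF norm_summable_imp_summable_on, of _ "{1..}"]) auto
  \<comment> \<open>A product of two geometric series, as
    \<open>s ^ level (i, j) = s ^ i * s ^ j\<close>.\<close>
  have "(\<lambda>v. s ^ level v) summable_on ({1..} \<times> {1..})"
  proof (rule summable_on_SigmaI)
    fix i :: nat
    show "((\<lambda>j. s ^ level (i, j)) has_sum s ^ i * infsum (\<lambda>i. s ^ i) {1..}) {1..}"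
      using has_sum_cmult_right[OF has_sum_infsum[OF s]] by (simp add: level_def power_add)
  next
    show "(\<lambda>i. s ^ i * infsum (\<lambda>i. s ^ i) {1..}) summable_on {1..}"
      using s by (rule summable_on_cmult_left)
  qed (use assms in auto)
  then show ?thesis by (simp add: lattice_verts_def)
qed

text \<open>The limit superior gives the bound on all levels from some \<open>S\<close> on; the
  finitely many vertices below are absorbed into \<open>C\<close>.\<close>

lemma weight_le_power_if_Limsup_less:
  assumes "Limsup lattice_at_infinity (\<lambda>(i, j). ereal (cmod (\<mu> (i, j)) powr (1 / real (i + j)))) < 2"
  obtains q C where "1 < q" "q < 2" "\<And>v. v \<in> lattice_verts \<Longrightarrow> cmod (\<mu> v) \<le> C * q ^ level v"
proof -
  let ?f = "\<lambda>(i, j). ereal (cmod (\<mu> (i, j)) powr (1 / real (i + j)))"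
  obtain q0 where q0: "Limsup lattice_at_infinity ?f < ereal q0" "ereal q0 < 2"
    using ereal_dense2[OF assms] by blast
  \<comment> \<open>Raising the rate to at least 3/2 ensures \<open>q ^ level v \<ge> 1\<close>, so
    that \<open>C\<close> alone dominates the weight on the low levels.\<close>
  define q where "q = max q0 (3 / 2)"
  have q: "1 < q" "q < 2" using q0(2) by (auto simp: q_def)
  have "eventually (\<lambda>v. ?f v < ereal q0) lattice_at_infinity"
    using Limsup_lessD[OF q0(1)] .
  then obtain S where S: "\<And>v. (case v of (i, j) \<Rightarrow> i + j) \<ge> S \<Longrightarrow> v \<in> lattice_verts \<Longrightarrow> ?f v < ereal q0"
    unfolding lattice_at_infinity_def eventually_inf_principal eventually_filtercomap_at_top_linorder
    by blast
  have large: "cmod (\<mu> v) \<le> q ^ level v" if v: "v \<in> lattice_verts" "level v \<ge> S" for v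
  proof -
    obtain i j where ij: "v = (i, j)" by (cases v)
    have pos: "real (i + j) > 0" using v by (auto simp: ij mem_lattice_verts_iff)
    have "cmod (\<mu> v) powr (1 / real (i + j)) \<le> q"
      using S[of v] v by (auto simp: ij level_def q_def)
    then have "(cmod (\<mu> v) powr (1 / real (i + j))) powr real (i + j) \<le> q powr real (i + j)"
      by (intro powr_mono2) auto
    moreover have "(cmod (\<mu> v) powr (1 / real (i + j))) powr real (i + j) = cmod (\<mu> v)"
      using pos by (simp only: powr_powr) simp
    moreover have "q powr real (i + j) = q ^ level v"
      using q by (simp only: powr_realpow ij level_def fst_conv snd_conv)
    ultimately show ?thesis by simp
  qed
  define T where "T = {v. level v < S}"
  have "T \<subseteq> {..S} \<times> {..S}" by (auto simp: T_def level_def)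
  then have fin: "finite T" by (rule finite_subset) simp
  define C where "C = 1 + (\<Sum>v\<in>T. cmod (\<mu> v))"
  have C: "C \<ge> 1" by (auto simp: C_def intro: sum_nonneg)
  have "cmod (\<mu> v) \<le> C * q ^ level v" if "v \<in> lattice_verts" for v
  proof (cases "v \<in> T")
    case True
    have "cmod (\<mu> v) \<le> C"
      using member_le_sum[OF True _ fin, of "\<lambda>v. cmod (\<mu> v)"] by (simp add: C_def)
    also have "\<dots> \<le> C * q ^ level v" using C q by (simp add: one_le_power)
    finally show ?thesis .
  next
    case False
    then have "cmod (\<mu> v) \<le> 1 * q ^ level v" using large that by (simp add: T_def)
    also have "\<dots> \<le> C * q ^ level v" using C q by (intro mult_right_mono) auto
    finally show ?thesis .
  qed
  then show thesis using q that by blast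
qed

section \<open>Dynamics of the lattice shift\<close>

context weighted_sequence_space
begin

section \<open>Norm estimates and a countable dense set\<close>

lemma diff_mem: "\<lbrakk>f \<in> X; g \<in> X\<rbrakk> \<Longrightarrow> (\<lambda>v. f v - g v) \<in> X"
  using add_mem[OF _ scale_mem[of g "- 1"]] by simp

lemma triangle_diff:
  assumes "f \<in> X" "g \<in> X" "h \<in> X"
  shows "N (\<lambda>v. f v - h v) \<le> N (\<lambda>v. f v - g v) + N (\<lambda>v. g v - h v)"
  using triangle[OF diff_mem[of f g] diff_mem[of g h]] assms by simp

text \<open>Comparison with the weighted l^1 norm is how membership and smallness of explicitly
  constructed functions are obtained in every \<open>X\<close> at once.\<close>

lemma dominated:
  assumes f: "f \<in> graph_functions V" and t: "t summable_on V"
    and le: "\<And>v. v \<in> V \<Longrightarrow> cmod (f v * \<mu> v) \<le> K * t v"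
  shows "f \<in> X" "N f \<le> K * infsum t V"
proof -
  have sum: "(\<lambda>v. cmod (f v * \<mu> v)) summable_on V"
    by (rule summable_on_comparison_test[OF summable_on_cmult_right[OF t]]) (use le in auto)
  show "f \<in> X" using f sum by (rule l1_mem)
  have "N f \<le> (\<Sum>\<^sub>\<infinity>v\<in>V. cmod (f v * \<mu> v))" using f sum by (rule l1_le)
  also have "\<dots> \<le> (\<Sum>\<^sub>\<infinity>v\<in>V. K * t v)"
    using sum summable_on_cmult_right[OF t] le by (rule infsum_mono)
  finally show "N f \<le> K * infsum t V" by (simp add: infsum_cmult_right')
qed

lemma finite_support:
  assumes F: "finite F" "F \<subseteq> V" and f: "\<And>v. v \<notin> F \<Longrightarrow> f v = 0"
  shows "f \<in> X" "N f \<le> (\<Sum>v\<in>F. cmod (f v * \<mu> v))"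
proof -
  have t: "(\<lambda>v. if v \<in> F then cmod (f v * \<mu> v) else 0) summable_on V \<longleftrightarrow>
      (\<lambda>v. cmod (f v * \<mu> v)) summable_on F"
    using F by (intro summable_on_cong_neutral) auto
  have i: "(\<Sum>\<^sub>\<infinity>v\<in>V. if v \<in> F then cmod (f v * \<mu> v) else 0) = (\<Sum>\<^sub>\<infinity>v\<in>F. cmod (f v * \<mu> v))"
    using F by (intro infsum_cong_neutral) auto
  have "f \<in> graph_functions V" using F f by (auto simp: graph_functions_def)
  from dominated[OF this, of "\<lambda>v. if v \<in> F then cmod (f v * \<mu> v) else 0" 1]
  show "f \<in> X" "N f \<le> (\<Sum>v\<in>F. cmod (f v * \<mu> v))"
    using t i F f by (auto simp: summable_on_finite)
qed

lemma zero_mem: "(\<lambda>_. 0) \<in> X"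
  by (rule finite_support[of "{}"]) auto

text \<open>Cut \<open>f\<close> down to a finite set by \<open>finite_approx\<close>, then replace
  each remaining value by a nearby element of a countable dense set \<open>Q\<close> of complex
  numbers.\<close>

lemma countable_dense:
  assumes V: "countable V"
  obtains D where "countable D"
    "\<And>g. g \<in> D \<Longrightarrow> \<exists>F. finite F \<and> F \<subseteq> V \<and> (\<forall>v. v \<notin> F \<longrightarrow> g v = 0)"
    "\<And>f e. f \<in> X \<Longrightarrow> e > 0 \<Longrightarrow> \<exists>g\<in>D. N (\<lambda>v. f v - g v) < e"
proof -
  obtain Q :: "complex set" where Q: "countable Q"
    "\<And>U. open U \<Longrightarrow> U \<noteq> {} \<Longrightarrow> \<exists>d\<in>Q. d \<in> U"
    using countable_dense_setE by metis
  \<comment> \<open>Elements of \<open>Pi\<^sub>E\<close> are \<open>undefined\<close> outside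
    \<open>F\<close>; they are reset to 0 there.\<close>
  define E where "E F = (\<lambda>f v. if v \<in> F then f v else 0) ` (Pi\<^sub>E F (\<lambda>_. Q))" for F :: "'v set"
  define D where "D = (\<Union>F\<in>{F. finite F \<and> F \<subseteq> V}. E F)"
  show thesis
  proof (rule that)
    show "countable D"
      unfolding D_def E_def using V Q(1)
      by (intro countable_UN countable_Collect_finite_subset countable_image countable_PiE) auto
  next
    fix g assume "g \<in> D"
    then obtain F where "finite F" "F \<subseteq> V" "g \<in> E F" by (auto simp: D_def)
    then show "\<exists>F. finite F \<and> F \<subseteq> V \<and> (\<forall>v. v \<notin> F \<longrightarrow> g v = 0)"
      by (intro exI[of _ F]) (auto simp: E_def)
  next
    fix f and e :: real assume f: "f \<in> X" and e: "e > 0"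
    obtain F where F: "finite F" "F \<subseteq> V" "N (\<lambda>v. if v \<in> F then 0 else f v) < e / 2"
      using finite_approx[OF f, of "e / 2"] e by auto
    \<comment> \<open>The summand 1 keeps \<open>S\<close> positive for empty \<open>F\<close> and
      makes the estimate \<open>d * (S - 1) < d * S\<close> strict.\<close>
    define S where "S = 1 + (\<Sum>v\<in>F. cmod (\<mu> v))"
    have S: "S > 0" by (auto simp: S_def intro!: add_pos_nonneg sum_nonneg)
    define d where "d = e / 2 / S"
    have d: "d > 0" using e S by (simp add: d_def)
    have "\<exists>z\<in>Q. dist (f v) z < d" for v
      using Q(2)[of "ball (f v) d"] d by auto
    then obtain z where z: "\<And>v. z v \<in> Q" "\<And>v. dist (f v) (z v) < d" by metis
    define g where "g v = (if v \<in> F then z v else 0)" for v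
    have "g = (\<lambda>f v. if v \<in> F then f v else 0) (restrict z F)"
      by (auto simp: g_def fun_eq_iff)
    moreover have "restrict z F \<in> Pi\<^sub>E F (\<lambda>_. Q)" using z by auto
    ultimately have "g \<in> E F" unfolding E_def by (rule image_eqI)
    then have gD: "g \<in> D" using F by (auto simp: D_def)
    let ?a = "\<lambda>v. if v \<in> F then f v - g v else 0"
    let ?b = "\<lambda>v. if v \<in> F then 0 else f v"
    have fF: "(\<lambda>v. if v \<in> F then f v else 0) \<in> X"
      by (rule finite_support(1)[OF F(1,2)]) auto
    have b: "?b \<in> X"
    proof -
      have "?b = (\<lambda>v. f v - (if v \<in> F then f v else 0))" by auto
      then show ?thesis using diff_mem[OF f fF] by simp
    qed
    have a: "?a \<in> X" "N ?a \<le> (\<Sum>v\<in>F. cmod (?a v * \<mu> v))"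
      by (rule finite_support[OF F(1,2)]; simp)+
    have "(\<Sum>v\<in>F. cmod (?a v * \<mu> v)) \<le> (\<Sum>v\<in>F. d * cmod (\<mu> v))"
      using less_imp_le[OF z(2)]
      by (intro sum_mono) (auto simp: norm_mult g_def dist_norm intro!: mult_right_mono)
    also have "\<dots> = d * (S - 1)" by (simp add: S_def sum_distrib_left)
    also have "\<dots> < d * S" using d by simp
    also have "\<dots> = e / 2" using S by (simp add: d_def)
    finally have "N ?a < e / 2" using a(2) by simp
    moreover have "(\<lambda>v. f v - g v) = (\<lambda>v. ?a v + ?b v)" by (auto simp: g_def)
    ultimately have "N (\<lambda>v. f v - g v) < e"
      using triangle[OF a(1) b] F(3) by simp
    then show "\<exists>g\<in>D. N (\<lambda>v. f v - g v) < e" using gD by blast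
  qed
qed

lemma openin_ball:
  assumes f: "f \<in> X"
  shows "openin (norm_topology X N) {g \<in> X. N (\<lambda>v. f v - g v) < r}"
  unfolding openin_norm_topology
proof (intro conjI ballI)
  fix g assume g: "g \<in> {g \<in> X. N (\<lambda>v. f v - g v) < r}"
  have "{h \<in> X. N (\<lambda>v. g v - h v) < r - N (\<lambda>v. f v - g v)} \<subseteq> {h \<in> X. N (\<lambda>v. f v - h v) < r}"
  proof safe
    fix h assume "h \<in> X" "N (\<lambda>v. g v - h v) < r - N (\<lambda>v. f v - g v)"
    then show "N (\<lambda>v. f v - h v) < r" using triangle_diff[OF f, of g h] g by auto
  qed
  then show "\<exists>s>0. {h \<in> X. N (\<lambda>v. g v - h v) < s} \<subseteq> {h \<in> X. N (\<lambda>v. f v - h v) < r}"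
    using g by (intro exI[of _ "r - N (\<lambda>v. f v - g v)"]) auto
qed auto

end

section \<open>Orbit closures and elementary estimates\<close>

lemma closure_of_witness:
  assumes "x \<in> \<T> closure_of S" "openin \<T> U" "x \<in> U"
  obtains y where "y \<in> S" "y \<in> U"
  using assms by (auto simp: in_closure_of)

lemma funpow_map_prod:
  fixes S :: "'a \<Rightarrow> 'a" and T :: "'b \<Rightarrow> 'b"
  shows "(map_prod S T ^^ n) (x, y) = ((S ^^ n) x, (T ^^ n) y)"
  by (induction n) auto

text \<open>Testing density of the product orbit on open sets
  \<open>U \<times> topspace \<T>\<close> shows that its first coordinate has a dense orbit.\<close>

lemma weakly_mixing_imp_hypercyclic:
  assumes "weakly_mixing_on \<T> T"
  shows "hypercyclic_on \<T> T"
proof -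
  obtain x y where x: "x \<in> topspace \<T>"
    and cl: "prod_topology \<T> \<T> closure_of range (\<lambda>n. (map_prod T T ^^ n) (x, y)) = topspace \<T> \<times> topspace \<T>"
    using assms by (auto simp: weakly_mixing_on_def hypercyclic_on_def)
  have "a \<in> \<T> closure_of range (\<lambda>n. (T ^^ n) x)" if a: "a \<in> topspace \<T>" for a
    unfolding in_closure_of
  proof (intro conjI allI impI)
    fix U assume U: "a \<in> U \<and> openin \<T> U"
    then have op: "openin (prod_topology \<T> \<T>) (U \<times> topspace \<T>)"
      by (simp add: openin_prod_Times_iff)
    have "(a, a) \<in> prod_topology \<T> \<T> closure_of range (\<lambda>n. (map_prod T T ^^ n) (x, y))"
      "(a, a) \<in> U \<times> topspace \<T>"
      using a U cl by simp_all
    then obtain p where "p \<in> range (\<lambda>n. (map_prod T T ^^ n) (x, y))" "p \<in> U \<times> topspace \<T>"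
      using closure_of_witness[OF _ op] by blast
    then show "\<exists>y. y \<in> range (\<lambda>n. (T ^^ n) x) \<and> y \<in> U"
      by (auto simp: funpow_map_prod)
  qed (rule a)
  then have "\<T> closure_of range (\<lambda>n. (T ^^ n) x) = topspace \<T>"
    by (intro subset_antisym[OF closure_of_subset_topspace] subsetI)
  then show ?thesis using x unfolding hypercyclic_on_def by blast
qed

lemma finite_support_level:
  assumes "finite F" "\<And>v. v \<notin> F \<Longrightarrow> g v = (0 :: complex)"
  obtains L where "\<And>v. level v \<ge> L \<Longrightarrow> g v = 0"
proof
  fix v assume v: "level v \<ge> Suc (\<Sum>u\<in>F. level u)"
  have "level v \<le> (\<Sum>u\<in>F. level u)" if "v \<in> F"
    using assms(1) that by (intro member_le_sum) auto
  then have "v \<notin> F" using v by linarith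
  then show "g v = 0" by (rule assms(2))
qed

lemma eventually_mult_power_less:
  fixes s M e :: real
  assumes "0 < s" "s < 1" "e > 0"
  shows "eventually (\<lambda>n. M * s ^ n < e) sequentially"
proof -
  have "(\<lambda>n. M * s ^ n) \<longlonglongrightarrow> M * 0"
    using assms by (intro tendsto_mult tendsto_const LIMSEQ_realpow_zero) auto
  then show ?thesis using assms by (intro order_tendstoD(2)) auto
qed

section \<open>Bounds for the iterates and decaying preimages\<close>

locale lattice_sequence_space = weighted_sequence_space lattice_verts \<mu> X N
  for \<mu> :: "nat \<times> nat \<Rightarrow> complex" and X N +
  assumes weight: "weight_on lattice_verts \<mu>"
    and bounded: "bounded_operator_on X N lattice_shift"
begin

text \<open>The weighted bound carries two factors: \<open>s ^ n\<close> tends to 0 with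
  \<open>n\<close>, while \<open>s ^ level v\<close> is summable over the vertices and so turns the
  pointwise estimate into a norm estimate.\<close>

definition decaying_right_inverse ::
  "real \<Rightarrow> (nat \<times> nat \<Rightarrow> complex) \<Rightarrow> (nat \<Rightarrow> nat \<times> nat \<Rightarrow> complex) \<Rightarrow> nat \<Rightarrow> real \<Rightarrow> bool" where
  "decaying_right_inverse s g h L K \<longleftrightarrow> K \<ge> 0 \<and>
    (\<forall>n. (lattice_shift ^^ n) (h n) = g \<and> h n \<in> graph_functions lattice_verts \<and>
      (\<forall>v\<in>lattice_verts. cmod (h n v * \<mu> v) \<le> K * s ^ n * s ^ level v) \<and>
      (\<forall>v\<in>lattice_verts. level v \<ge> n + L \<longrightarrow> h n v = 0))"

lemma norm_nonneg: "f \<in> X \<Longrightarrow> N f \<ge> 0"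
  using order_trans[OF norm_ge_zero coord_le[of f "(1, 1)"]] by (simp add: mem_lattice_verts_iff)

lemma shift_iter_mem: "f \<in> X \<Longrightarrow> (lattice_shift ^^ n) f \<in> X"
  using bounded by (induction n) (auto simp: bounded_operator_on_def)

lemma shift_iter_bound:
  obtains C where "C \<ge> 1" "\<And>f n. f \<in> X \<Longrightarrow> N ((lattice_shift ^^ n) f) \<le> C ^ n * N f"
proof -
  obtain C0 where C0: "\<And>f. f \<in> X \<Longrightarrow> N (lattice_shift f) \<le> C0 * N f"
    using bounded unfolding bounded_operator_on_def by blast
  \<comment> \<open>With \<open>C \<ge> 1\<close> the bounds \<open>C ^ n\<close> increase in
    \<open>n\<close>, which is used when the times of a hypercyclic vector are compared.\<close>
  define C where "C = max 1 C0"
  have "N ((lattice_shift ^^ n) f) \<le> C ^ n * N f" if f: "f \<in> X" for f n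
  proof (induction n)
    case (Suc n)
    let ?g = "(lattice_shift ^^ n) f"
    have "N (lattice_shift ?g) \<le> C0 * N ?g" using C0 shift_iter_mem[OF f] .
    also have "\<dots> \<le> C * N ?g"
      using norm_nonneg[OF shift_iter_mem[OF f]] by (intro mult_right_mono) (auto simp: C_def)
    also have "\<dots> \<le> C * (C ^ n * N f)"
      using Suc by (intro mult_left_mono) (auto simp: C_def)
    finally show ?case by simp
  qed simp
  then show thesis using that[of C] by (simp add: C_def)
qed

lemma lattice_right_inverse:
  assumes "Limsup lattice_at_infinity (\<lambda>(i, j). ereal (cmod (\<mu> (i, j)) powr (1 / real (i + j)))) < 2"
  obtains s :: real where "0 < s" "s < 1"
    "\<And>F (g :: nat \<times> nat \<Rightarrow> complex). finite F \<Longrightarrow> F \<subseteq> lattice_verts \<Longrightarrow> (\<And>v. v \<notin> F \<Longrightarrow> g v = 0) \<Longrightarrow>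
      \<exists>h L K. decaying_right_inverse s g h L K"
proof -
  obtain q C where q: "1 < q" "q < 2" and C: "\<And>v. v \<in> lattice_verts \<Longrightarrow> cmod (\<mu> v) \<le> C * q ^ level v"
    using weight_le_power_if_Limsup_less[OF assms] by blast
  \<comment> \<open>The condition \<open>q < 2\<close> is what leaves room for a decay rate
    \<open>r > 1/2\<close> of the preimages with \<open>r * q < 1\<close>.\<close>
  have "1 / 2 < 1 / q" using q by (simp add: field_simps)
  then obtain r where r: "1 / 2 < r" "r < 1 / q" using dense by blast
  \<comment> \<open>The square root splits \<open>(r * q) ^ level v\<close> into two equal factors;
    one is estimated by \<open>s ^ n\<close> since the support of \<open>h n\<close> starts at level
    \<open>n\<close>.\<close>
  define s where "s = sqrt (r * q)"
  have rq: "0 < r * q" "r * q < 1" using r q by (simp_all add: field_simps)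
  have s: "0 < s" "s < 1" using rq by (auto simp: s_def)
  have s2: "r * q = s * s" using rq by (simp add: s_def)
  show thesis
  proof (rule that[OF s])
    fix F and g :: "nat \<times> nat \<Rightarrow> complex"
    assume "finite F" "F \<subseteq> lattice_verts" "\<And>v. v \<notin> F \<Longrightarrow> g v = 0"
    then have "has_right_inverse r g" by (rule has_right_inverse_finite_support[OF r(1)])
    then obtain h L K where h: "\<And>n. (lattice_shift ^^ n) (h n) = g"
      "\<And>n. h n \<in> graph_functions lattice_verts"
      "\<And>n v. v \<in> lattice_verts \<Longrightarrow> cmod (h n v) \<le> K * r ^ level v"
      "\<And>n v. v \<in> lattice_verts \<Longrightarrow> h n v \<noteq> 0 \<Longrightarrow> n \<le> level v \<and> level v < n + L"
      unfolding has_right_inverse_def by blast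
    have "cmod (h n v * \<mu> v) \<le> \<bar>K * C\<bar> * s ^ n * s ^ level v" if v: "v \<in> lattice_verts" for n v
    proof (cases "h n v = 0")
      case True
      then show ?thesis using s by simp
    next
      case False
      have "cmod (h n v * \<mu> v) \<le> (K * r ^ level v) * (C * q ^ level v)"
        unfolding norm_mult using h(3)[OF v, of n] C[OF v] order_trans[OF norm_ge_zero h(3)[OF v, of n]]
        by (intro mult_mono) auto
      also have "\<dots> = (K * C) * (r * q) ^ level v" by (simp add: power_mult_distrib)
      also have "\<dots> \<le> \<bar>K * C\<bar> * (r * q) ^ level v" using rq by (intro mult_right_mono) auto
      also have "\<dots> = \<bar>K * C\<bar> * s ^ level v * s ^ level v" by (simp add: s2 power_mult_distrib)
      also have "\<dots> \<le> \<bar>K * C\<bar> * s ^ n * s ^ level v"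
        using s h(4)[OF v False] by (intro mult_right_mono mult_left_mono power_decreasing) auto
      finally show ?thesis .
    qed
    moreover have "h n v = 0" if "v \<in> lattice_verts" "level v \<ge> n + L" for n v
      using h(4)[OF that(1), of n] that(2) by force
    ultimately show "\<exists>h L K. decaying_right_inverse s g h L K"
      unfolding decaying_right_inverse_def using h(1,2) by (intro exI[of _ h] exI[of _ L] exI[of _ "\<bar>K * C\<bar>"]) auto
  qed
qed

section \<open>Mixing below the critical growth rate\<close>

lemma mixing:
  assumes "Limsup lattice_at_infinity (\<lambda>(i, j). ereal (cmod (\<mu> (i, j)) powr (1 / real (i + j)))) < 2"
  shows "mixing_on (norm_topology X N) lattice_shift"
  unfolding mixing_on_def
proof (intro allI impI)
  fix U W assume UW: "openin (norm_topology X N) U \<and> openin (norm_topology X N) W \<and> U \<noteq> {} \<and> W \<noteq> {}"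
  obtain s where s: "0 < s" "s < 1" and inv: "\<And>F g. finite F \<Longrightarrow> F \<subseteq> lattice_verts \<Longrightarrow> (\<And>v. v \<notin> F \<Longrightarrow> g v = 0) \<Longrightarrow>
      \<exists>h L K. decaying_right_inverse s g h L K"
    using lattice_right_inverse[OF assms] by blast
  obtain D where D: "\<And>g. g \<in> D \<Longrightarrow> \<exists>F. finite F \<and> F \<subseteq> lattice_verts \<and> (\<forall>v. v \<notin> F \<longrightarrow> g v = 0)"
    "\<And>f e. f \<in> X \<Longrightarrow> e > 0 \<Longrightarrow> \<exists>g\<in>D. N (\<lambda>v. f v - g v) < e"
    by (rule countable_dense[OF countableI_type]) blast
  have DX: "g \<in> X" if "g \<in> D" for g
    using D(1)[OF that] finite_support(1) by blast
  have open_D: "\<exists>w\<in>D. w \<in> S" if S: "openin (norm_topology X N) S" "S \<noteq> {}" for S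
  proof -
    obtain w where w: "w \<in> S" "w \<in> X" using S by (auto simp: openin_norm_topology)
    then obtain e where e: "e > 0" "{g \<in> X. N (\<lambda>v. w v - g v) < e} \<subseteq> S"
      using S(1) unfolding openin_norm_topology by blast
    then show ?thesis using D(2)[OF w(2) e(1)] DX by blast
  qed
  obtain u where u: "u \<in> D" "u \<in> U" using open_D UW by blast
  obtain w where w: "w \<in> D" "w \<in> W" using open_D UW by blast
  obtain e where e: "e > 0" "{g \<in> X. N (\<lambda>v. u v - g v) < e} \<subseteq> U"
    using UW u(2) unfolding openin_norm_topology by blast
  obtain Fu where Fu: "finite Fu" "Fu \<subseteq> lattice_verts" "\<And>v. v \<notin> Fu \<Longrightarrow> u v = 0" using D(1)[OF u(1)] by blast
  obtain Lu where Lu: "\<And>v. level v \<ge> Lu \<Longrightarrow> u v = 0" using finite_support_level[of Fu u] Fu by blast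
  obtain Fw where Fw: "finite Fw" "Fw \<subseteq> lattice_verts" "\<And>v. v \<notin> Fw \<Longrightarrow> w v = 0" using D(1)[OF w(1)] by blast
  obtain h K where h: "\<And>n. (lattice_shift ^^ n) (h n) = w" "\<And>n. h n \<in> graph_functions lattice_verts"
    "\<And>n v. v \<in> lattice_verts \<Longrightarrow> cmod (h n v * \<mu> v) \<le> K * s ^ n * s ^ level v"
    using inv[of Fw w] Fw unfolding decaying_right_inverse_def by blast
  define A where "A = (\<Sum>\<^sub>\<infinity>v\<in>lattice_verts. s ^ level v)"
  have t: "(\<lambda>v. s ^ level v) summable_on lattice_verts" using s by (intro summable_on_power_level) auto
  obtain n0 where n0: "\<And>n. n \<ge> n0 \<Longrightarrow> (K * A) * s ^ n < e"
    using eventually_mult_power_less[OF s e(1)] unfolding eventually_sequentially by blast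
  \<comment> \<open>For large \<open>n\<close> the point \<open>u + h n\<close> is close to
    \<open>u\<close>, hence in \<open>U\<close>, and is mapped exactly to \<open>w\<close>: the
    power annihilates \<open>u\<close> once \<open>n \<ge> Lu\<close> and sends \<open>h n\<close>
    to \<open>w\<close>.\<close>
  show "\<exists>M. \<forall>n\<ge>M. (lattice_shift ^^ n) ` U \<inter> W \<noteq> {}"
  proof (intro exI[of _ "max n0 Lu"] allI impI)
    fix n assume n: "n \<ge> max n0 Lu"
    have hX: "h n \<in> X" by (rule dominated(1)[OF h(2) t h(3)])
    have "N (\<lambda>v. u v - (u v + h n v)) = N (\<lambda>v. - h n v)" by simp
    also have "\<dots> \<le> (K * s ^ n) * A"
      unfolding A_def using h(2)[of n] h(3)[of _ n]
      by (intro dominated(2) t) (auto simp: graph_functions_def)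
    also have "\<dots> < e" using n0[of n] n by (simp add: mult_ac)
    finally have "(\<lambda>v. u v + h n v) \<in> U"
      using e(2) add_mem[OF DX[OF u(1)] hX] by blast
    moreover have "(lattice_shift ^^ n) (\<lambda>v. u v + h n v) = w"
    proof -
      have "u \<in> graph_functions lattice_verts" using Fu by (auto simp: graph_functions_def)
      then have "(lattice_shift ^^ n) u = (\<lambda>_. 0)"
        using Lu n by (intro lattice_shift_iter_vanishes) auto
      then show ?thesis by (simp add: lattice_shift_iter_add h(1))
    qed
    ultimately show "(lattice_shift ^^ n) ` U \<inter> W \<noteq> {}" using w by force
  qed
qed

section \<open>Bounded orbit coordinates at the critical growth rate\<close>

lemma not_hypercyclic:
  assumes c: "c > 0" and le: "\<And>i j. (i, j) \<in> lattice_verts \<Longrightarrow> cmod (\<mu> (i, j)) \<ge> c * 2 ^ (i + j)"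
  shows "\<not> hypercyclic_on (norm_topology X N) lattice_shift"
proof
  assume "hypercyclic_on (norm_topology X N) lattice_shift"
  then obtain f where f: "f \<in> X"
    and cl: "norm_topology X N closure_of range (\<lambda>n. (lattice_shift ^^ n) f) = X"
    by (auto simp: hypercyclic_on_def)
  define K where "K = N f / c"
  \<comment> \<open>The bound \<open>K / 2 ^ level v\<close> reproduces itself: \<open>v\<close> has two children, both one level higher.\<close>
  have orbit: "cmod ((lattice_shift ^^ n) f v) \<le> K / 2 ^ level v" if "v \<in> lattice_verts" for n v
    using that
  proof (induction n arbitrary: v)
    case 0
    obtain i j where v: "v = (i, j)" by (cases v)
    have "cmod (f v) * (c * 2 ^ level v) \<le> cmod (f v) * cmod (\<mu> v)"
      using le[of i j] 0 by (intro mult_left_mono) (auto simp: v level_def)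
    also have "\<dots> \<le> N f" using coord_le[OF f 0] by (simp add: norm_mult)
    finally show ?case using c by (simp add: K_def field_simps)
  next
    case (Suc n)
    obtain i j where v: "v = (i, j)" by (cases v)
    let ?g = "(lattice_shift ^^ n) f"
    have "cmod (?g (i, Suc j)) \<le> K / 2 ^ Suc (level v)" "cmod (?g (Suc i, j)) \<le> K / 2 ^ Suc (level v)"
      using Suc.IH[of "(i, Suc j)"] Suc.IH[of "(Suc i, j)"] Suc.prems
      by (auto simp: v level_def mem_lattice_verts_iff)
    then have "cmod (?g (i, Suc j) + ?g (Suc i, j)) \<le> K / 2 ^ Suc (level v) + K / 2 ^ Suc (level v)"
      by (rule norm_triangle_mono)
    then show ?case using Suc.prems by (simp add: v lattice_shift_apply mem_lattice_verts_iff)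
  qed
  let ?o = "(1, 1) :: nat \<times> nat"
  have o: "?o \<in> lattice_verts" by (simp add: mem_lattice_verts_iff)
  have mu: "cmod (\<mu> ?o) > 0" using weight o by (auto simp: weight_on_def)
  \<comment> \<open>The target exceeds the orbit bound at the corner vertex by 1, while the ball of
    radius \<open>cmod (\<mu> ?o)\<close> about \<open>g\<close> forces the values there to differ
    by less than 1.\<close>
  define g where "g = (\<lambda>v. complex_of_real (K / 2 ^ level ?o + 1) * delta ?o v)"
  have g: "g \<in> X" using o by (intro finite_support(1)[of "{?o}"]) (auto simp: g_def delta_def)
  have "g \<in> norm_topology X N closure_of range (\<lambda>n. (lattice_shift ^^ n) f)" using g cl by simp
  \<comment> \<open>The centre lies in its ball, as the zero function has norm at most an empty
    sum.\<close>
  moreover have "N (\<lambda>v. g v - g v) < cmod (\<mu> ?o)"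
    using finite_support(2)[of "{}" "\<lambda>_. 0"] mu by (simp del: zero_less_norm_iff)
  ultimately obtain y where "y \<in> range (\<lambda>n. (lattice_shift ^^ n) f)"
    and y: "y \<in> {h \<in> X. N (\<lambda>v. g v - h v) < cmod (\<mu> ?o)}"
    using g closure_of_witness[OF _ openin_ball[OF g, of "cmod (\<mu> ?o)"]] by blast
  then obtain n where n: "N (\<lambda>v. g v - (lattice_shift ^^ n) f v) < cmod (\<mu> ?o)"
    by auto
  let ?x = "(lattice_shift ^^ n) f ?o"
  have "cmod (g ?o - ?x) * cmod (\<mu> ?o) < cmod (\<mu> ?o)"
    using coord_le[OF diff_mem[OF g shift_iter_mem[OF f]] o, of n] n by (simp add: norm_mult)
  then have "cmod (g ?o - ?x) < 1" using mu by simp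
  moreover have "K \<ge> 0" using norm_nonneg[OF f] c by (simp add: K_def)
  then have "cmod (g ?o) = K / 2 ^ level ?o + 1"
    by (simp add: g_def delta_def norm_mult del: of_real_add)
  ultimately show False
    using orbit[OF o, of n] norm_triangle_ineq2[of "g ?o" ?x] by linarith
qed

section \<open>A dense orbit for the direct sum\<close>

text \<open>
  The orbit of \<open>x = \<Sum>k. f k\<close> at time \<open>n k\<close> approximates \<open>g k\<close>: the earlier terms have been
  annihilated, and the later ones are small enough to absorb the factor \<open>C ^ n k\<close>. The series
  converges pointwise and is dominated by a summable function, so completeness of \<open>X\<close> is not needed.
\<close>

lemma orbit_approximates:
  fixes f g :: "nat \<Rightarrow> nat \<times> nat \<Rightarrow> complex"
  assumes s: "0 < s" "s < 1"
    and C: "C \<ge> 1" "\<And>f n. f \<in> X \<Longrightarrow> N ((lattice_shift ^^ n) f) \<le> C ^ n * N f"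
    and f: "\<And>k. (lattice_shift ^^ n k) (f k) = g k" "\<And>k. f k \<in> graph_functions lattice_verts"
    and small: "\<And>k v. v \<in> lattice_verts \<Longrightarrow> cmod (f k v * \<mu> v) \<le> (1 / 2) ^ k * s ^ level v"
    and small': "\<And>j k v. j < k \<Longrightarrow> v \<in> lattice_verts \<Longrightarrow>
      C ^ n j * cmod (f k v * \<mu> v) \<le> (1 / 2) ^ k * s ^ level v"
    and vanish: "\<And>j k v. j < k \<Longrightarrow> v \<in> lattice_verts \<Longrightarrow> level v \<ge> n k \<Longrightarrow> f j v = 0"
  obtains x where "x \<in> X"
    "\<And>k. N (\<lambda>v. g k v - (lattice_shift ^^ n k) x v) \<le> (\<Sum>\<^sub>\<infinity>v\<in>lattice_verts. s ^ level v) * (1 / 2) ^ k"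
proof -
  have t: "(\<lambda>v. s ^ level v) summable_on lattice_verts" using s by (intro summable_on_power_level) auto
  have out: "f k v = 0" if "v \<notin> lattice_verts" for k v
    using f(2)[of k] that unfolding graph_functions_def by blast
  have sum_f: "summable (\<lambda>k. f k v)" for v
  proof (cases "v \<in> lattice_verts")
    case True
    then have mu: "cmod (\<mu> v) > 0" using weight by (auto simp: weight_on_def)
    show ?thesis
    proof (rule summable_comparison_test'[where N = 0])
      show "summable (\<lambda>k. (s ^ level v / cmod (\<mu> v)) * (1 / 2 :: real) ^ k)"
        by (intro summable_mult summable_geometric) simp
      fix k show "norm (f k v) \<le> (s ^ level v / cmod (\<mu> v)) * (1 / 2) ^ k"
        using small[OF True, of k] mu by (simp add: norm_mult field_simps)
    qed
  qed (simp add: out)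
  define x where "x v = (\<Sum>k. f k v)" for v
  \<comment> \<open>The series is split at \<open>k\<close> into past terms, the term
    \<open>f k\<close> and the future terms \<open>tail k\<close>.\<close>
  define tail where "tail k v = (\<Sum>j. f (j + Suc k) v)" for k v
  have split: "x = (\<lambda>v. (\<Sum>j<k. f j v) + (f k v + tail k v))" for k
  proof
    fix v
    have "x v = tail k v + (\<Sum>j<Suc k. f j v)"
      unfolding x_def tail_def by (rule suminf_split_initial_segment[OF sum_f])
    then show "x v = (\<Sum>j<k. f j v) + (f k v + tail k v)" by simp
  qed
  have tail_graph: "tail k \<in> graph_functions lattice_verts" for k
    by (auto simp: graph_functions_def tail_def out)
  have tail_le: "cmod (tail k v * \<mu> v) \<le> ((1 / 2) ^ k / C ^ n k) * s ^ level v"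
    if v: "v \<in> lattice_verts" for k v
  proof -
    \<comment> \<open>The powers of 1/2 with exponents beyond \<open>k\<close> add up to exactly
      \<open>(1 / 2) ^ k\<close>.\<close>
    have geo: "(\<lambda>j. (1 / 2 :: real) ^ (j + Suc k)) sums ((1 / 2) ^ k)"
    proof -
      have "(\<lambda>j. (1 / 2 :: real) ^ Suc k * (1 / 2) ^ j) sums ((1 / 2) ^ Suc k * (1 / (1 - 1 / 2)))"
        by (intro sums_mult geometric_sums) simp
      then show ?thesis by (simp add: power_add mult.commute)
    qed
    have le: "cmod (f (j + Suc k) v * \<mu> v) \<le> (s ^ level v / C ^ n k) * (1 / 2) ^ (j + Suc k)" for j
      using small'[of k "j + Suc k" v] v C(1) by (simp add: field_simps)
    have "tail k v * \<mu> v = (\<Sum>j. f (j + Suc k) v * \<mu> v)"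
      unfolding tail_def using sum_f[of v] by (intro suminf_mult2) (subst summable_iff_shift)
    also have "cmod \<dots> \<le> (\<Sum>j. (s ^ level v / C ^ n k) * (1 / 2) ^ (j + Suc k))"
      using le sums_summable[OF geo] by (intro norm_suminf_le summable_mult) auto
    also have "\<dots> = (s ^ level v / C ^ n k) * (1 / 2) ^ k"
      using sums_unique[OF sums_mult[OF geo]] by metis
    finally show ?thesis by (simp add: mult_ac)
  qed
  have tail_X: "tail k \<in> X" and tail_N: "N (tail k) \<le> ((1 / 2) ^ k / C ^ n k) * (\<Sum>\<^sub>\<infinity>v\<in>lattice_verts. s ^ level v)" for k
    using dominated[OF tail_graph t tail_le] by blast+
  have "f 0 \<in> X" by (rule dominated(1)[OF f(2) t small])
  then have xX: "x \<in> X" using add_mem[OF _ tail_X[of 0]] split[of 0] by simp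
  have "N (\<lambda>v. g k v - (lattice_shift ^^ n k) x v) \<le> (\<Sum>\<^sub>\<infinity>v\<in>lattice_verts. s ^ level v) * (1 / 2) ^ k" for k
  proof -
    have "(lattice_shift ^^ n k) (\<lambda>v. \<Sum>j<k. f j v) = (\<lambda>_. 0)"
      using vanish out by (intro lattice_shift_iter_vanishes) (auto simp: graph_functions_def)
    then have eq: "(lattice_shift ^^ n k) x = (\<lambda>v. g k v + (lattice_shift ^^ n k) (tail k) v)"
      by (subst split[of k]) (simp add: lattice_shift_iter_add f(1))
    have "N (\<lambda>v. g k v - (lattice_shift ^^ n k) x v) = N (\<lambda>v. (lattice_shift ^^ n k) x v - g k v)"
      by (rule diff_commute)
    also have "\<dots> = N ((lattice_shift ^^ n k) (tail k))" by (simp add: eq)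
    also have "\<dots> \<le> C ^ n k * N (tail k)" by (rule C(2)[OF tail_X])
    also have "\<dots> \<le> C ^ n k * (((1 / 2) ^ k / C ^ n k) * (\<Sum>\<^sub>\<infinity>v\<in>lattice_verts. s ^ level v))"
      using C(1) tail_N by (intro mult_left_mono) auto
    also have "\<dots> = (\<Sum>\<^sub>\<infinity>v\<in>lattice_verts. s ^ level v) * (1 / 2) ^ k" using C(1) by simp
    finally show ?thesis .
  qed
  then show thesis using that xX by blast
qed

lemma weakly_mixing:
  assumes "Limsup lattice_at_infinity (\<lambda>(i, j). ereal (cmod (\<mu> (i, j)) powr (1 / real (i + j)))) < 2"
  shows "weakly_mixing_on (norm_topology X N) lattice_shift"
proof -
  obtain s where s: "0 < s" "s < 1" and inv: "\<And>F g. finite F \<Longrightarrow> F \<subseteq> lattice_verts \<Longrightarrow> (\<And>v. v \<notin> F \<Longrightarrow> g v = 0) \<Longrightarrow>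
      \<exists>h L K. decaying_right_inverse s g h L K"
    using lattice_right_inverse[OF assms] by blast
  obtain C where C: "C \<ge> 1" "\<And>f n. f \<in> X \<Longrightarrow> N ((lattice_shift ^^ n) f) \<le> C ^ n * N f"
    using shift_iter_bound by blast
  obtain D where D: "countable D"
    "\<And>g. g \<in> D \<Longrightarrow> \<exists>F. finite F \<and> F \<subseteq> lattice_verts \<and> (\<forall>v. v \<notin> F \<longrightarrow> g v = 0)"
    "\<And>f e. f \<in> X \<Longrightarrow> e > 0 \<Longrightarrow> \<exists>g\<in>D. N (\<lambda>v. f v - g v) < e"
    by (rule countable_dense[OF countableI_type]) blast
  have DX: "g \<in> X" if "g \<in> D" for g
    using D(2)[OF that] finite_support(1) by blast
  have "\<exists>h L K. decaying_right_inverse s g h L K" if g: "g \<in> D" for g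
  proof -
    obtain F where "finite F" "F \<subseteq> lattice_verts" "\<And>v. v \<notin> F \<Longrightarrow> g v = 0" using D(2)[OF g] by blast
    then show ?thesis by (rule inv)
  qed
  then obtain h L K where "\<And>g. g \<in> D \<Longrightarrow> decaying_right_inverse s g (h g) (L g) (K g)"
    by metis
  then have K: "\<And>g. g \<in> D \<Longrightarrow> K g \<ge> 0"
    and h: "\<And>g n. g \<in> D \<Longrightarrow> (lattice_shift ^^ n) (h g n) = g"
      "\<And>g n. g \<in> D \<Longrightarrow> h g n \<in> graph_functions lattice_verts"
      "\<And>g n v. g \<in> D \<Longrightarrow> v \<in> lattice_verts \<Longrightarrow> cmod (h g n v * \<mu> v) \<le> K g * s ^ n * s ^ level v"
      "\<And>g n v. g \<in> D \<Longrightarrow> v \<in> lattice_verts \<Longrightarrow> level v \<ge> n + L g \<Longrightarrow> h g n v = 0"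
    unfolding decaying_right_inverse_def by blast+
  have D_ne: "D \<times> D \<noteq> {}" using D(3)[OF zero_mem zero_less_one] by blast
  \<comment> \<open>Every pair in \<open>D \<times> D\<close> occurs as \<open>G k\<close> for arbitrarily large \<open>k\<close>.\<close>
  define G where "G k = from_nat_into (D \<times> D) (fst (prod_decode k))" for k
  have G: "fst (G k) \<in> D" "snd (G k) \<in> D" for k
    using from_nat_into[OF D_ne] by (auto simp: G_def mem_Times_iff)
  \<comment> \<open>Taking maxima over both components of \<open>G k\<close> lets one sequence of
    times serve both coordinates.\<close>
  define M where "M k = max (K (fst (G k))) (K (snd (G k)))" for k
  define R where "R k = max (L (fst (G k))) (L (snd (G k)))" for k
  \<comment> \<open>The times are chosen recursively: the preimages at time \<open>n k\<close> must
    be small, \<open>n (Suc k)\<close> must lie beyond their support, and the next preimages must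
    beat the growth \<open>C ^ n k\<close>. Only neighbouring indices are related here;
    \<open>n_R\<close> and \<open>n_small\<close> extend this to all \<open>j < k\<close>.\<close>
  have "\<exists>n. \<forall>k. M k * s ^ n k \<le> (1 / 2) ^ k \<and>
      (n k + R k \<le> n (Suc k) \<and> M (Suc k) * C ^ n k * s ^ n (Suc k) \<le> (1 / 2) ^ Suc k)"
  proof (rule dependent_nat_choice)
    show "\<exists>x. M 0 * s ^ x \<le> (1 / 2) ^ 0"
      using eventually_happens[OF eventually_mult_power_less[OF s, of 1 "M 0"]] by (auto intro: less_imp_le)
  next
    fix n k
    have "eventually (\<lambda>m. M (Suc k) * C ^ n * s ^ m < (1 / 2) ^ Suc k) sequentially"
      by (rule eventually_mult_power_less[OF s]) simp
    then have "eventually (\<lambda>m. n + R k \<le> m \<and> M (Suc k) * C ^ n * s ^ m < (1 / 2) ^ Suc k) sequentially"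
      using eventually_ge_at_top[of "n + R k"] by eventually_elim auto
    then obtain m where m: "n + R k \<le> m" "M (Suc k) * C ^ n * s ^ m < (1 / 2) ^ Suc k"
      using eventually_happens by fastforce
    \<comment> \<open>As \<open>C ^ n \<ge> 1\<close>, smallness after multiplication by
      \<open>C ^ n\<close> implies plain smallness at the new index.\<close>
    have "M (Suc k) * 1 * s ^ m \<le> M (Suc k) * C ^ n * s ^ m"
      using C(1) K[OF G(1)] s by (intro mult_right_mono mult_left_mono) (auto simp: M_def le_max_iff_disj)
    then show "\<exists>y. M (Suc k) * s ^ y \<le> (1 / 2) ^ Suc k \<and>
        n + R k \<le> y \<and> M (Suc k) * C ^ n * s ^ y \<le> (1 / 2) ^ Suc k"
      using m by (intro exI[of _ m]) auto
  qed
  then obtain n where n: "\<And>k. M k * s ^ n k \<le> (1 / 2) ^ k" "\<And>k. n k + R k \<le> n (Suc k)"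
    "\<And>k. M (Suc k) * C ^ n k * s ^ n (Suc k) \<le> (1 / 2) ^ Suc k" by blast
  have n_mono: "n j \<le> n k" if "j \<le> k" for j k
    by (rule lift_Suc_mono_le[OF _ that]) (use n(2) add_leD1 in blast)
  have n_R: "n j + R j \<le> n k" if "j < k" for j k
    using n(2)[of j] n_mono[of "Suc j" k] that by simp
  have n_small: "M k * C ^ n j * s ^ n k \<le> (1 / 2) ^ k" if jk: "j < k" for j k
  proof -
    obtain k' where k': "k = Suc k'" "j \<le> k'" using jk by (cases k) auto
    have "M k * C ^ n j * s ^ n k \<le> M k * C ^ n k' * s ^ n k"
      using C(1) K[OF G(1)] s n_mono[OF k'(2)]
      by (intro mult_right_mono mult_left_mono power_increasing) (auto simp: M_def le_max_iff_disj)
    then show ?thesis using n(3)[of k'] by (simp add: k'(1))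
  qed
  define A where "A = (\<Sum>\<^sub>\<infinity>v\<in>lattice_verts. s ^ level v)"
  have orbit: "\<exists>x\<in>X. \<forall>k. N (\<lambda>v. g k v - (lattice_shift ^^ n k) x v) \<le> A * (1 / 2) ^ k"
    if g: "\<And>k. g k \<in> D" and KM: "\<And>k. K (g k) \<le> M k" and LR: "\<And>k. L (g k) \<le> R k" for g
  proof -
    have bound: "cmod (h (g k) (n k) v * \<mu> v) \<le> M k * s ^ n k * s ^ level v" if "v \<in> lattice_verts" for k v
      using s KM[of k] by (intro order_trans[OF h(3)[OF g that]] mult_right_mono) auto
    obtain x where "x \<in> X" "\<And>k. N (\<lambda>v. g k v - (lattice_shift ^^ n k) x v) \<le> A * (1 / 2) ^ k"
      unfolding A_def
    proof (rule orbit_approximates[OF s C, where f = "\<lambda>k. h (g k) (n k)" and n = n and g = g])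
      fix k v assume v: "v \<in> lattice_verts"
      show "cmod (h (g k) (n k) v * \<mu> v) \<le> (1 / 2) ^ k * s ^ level v"
        using s by (intro order_trans[OF bound[OF v]] mult_right_mono n(1)) auto
    next
      fix j k v assume jk: "(j::nat) < k" and v: "v \<in> lattice_verts"
      have "C ^ n j * cmod (h (g k) (n k) v * \<mu> v) \<le> C ^ n j * (M k * s ^ n k * s ^ level v)"
        using C(1) by (intro mult_left_mono bound v) auto
      also have "\<dots> = (M k * C ^ n j * s ^ n k) * s ^ level v" by (simp add: mult_ac)
      also have "\<dots> \<le> (1 / 2) ^ k * s ^ level v"
        using s by (intro mult_right_mono n_small jk) auto
      finally show "C ^ n j * cmod (h (g k) (n k) v * \<mu> v) \<le> (1 / 2) ^ k * s ^ level v" .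
    next
      fix j k v assume jk: "(j::nat) < k" and v: "v \<in> lattice_verts" "n k \<le> level v"
      show "h (g j) (n j) v = 0"
        using n_R[OF jk] LR[of j] v(2) by (intro h(4)[OF g v(1)]) linarith
    qed (use h(1,2) g in blast)+
    then show ?thesis by blast
  qed
  have "\<exists>x\<in>X. \<forall>k. N (\<lambda>v. fst (G k) v - (lattice_shift ^^ n k) x v) \<le> A * (1 / 2) ^ k"
    using G by (intro orbit) (auto simp: M_def R_def)
  then obtain x where x: "x \<in> X" "\<And>k. N (\<lambda>v. fst (G k) v - (lattice_shift ^^ n k) x v) \<le> A * (1 / 2) ^ k"
    by blast
  have "\<exists>x\<in>X. \<forall>k. N (\<lambda>v. snd (G k) v - (lattice_shift ^^ n k) x v) \<le> A * (1 / 2) ^ k"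
    using G by (intro orbit) (auto simp: M_def R_def)
  then obtain y where y: "y \<in> X" "\<And>k. N (\<lambda>v. snd (G k) v - (lattice_shift ^^ n k) y v) \<le> A * (1 / 2) ^ k"
    by blast
  let ?\<T> = "norm_topology X N"
  let ?O = "range (\<lambda>n. (map_prod lattice_shift lattice_shift ^^ n) (x, y))"
  have "p \<in> prod_topology ?\<T> ?\<T> closure_of ?O" if p: "p \<in> X \<times> X" for p
    unfolding in_closure_of
  proof (intro conjI allI impI)
    show "p \<in> topspace (prod_topology ?\<T> ?\<T>)" using p by simp
    fix T assume T: "p \<in> T \<and> openin (prod_topology ?\<T> ?\<T>) T"
    obtain a b where ab: "p = (a, b)" "a \<in> X" "b \<in> X" using p by blast
    obtain U W where UW: "openin ?\<T> U" "openin ?\<T> W" "a \<in> U" "b \<in> W" "U \<times> W \<subseteq> T"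
      using T unfolding ab(1) openin_prod_topology_alt by blast
    obtain r1 where r1: "r1 > 0" "{g \<in> X. N (\<lambda>v. a v - g v) < r1} \<subseteq> U"
      using UW(1,3) unfolding openin_norm_topology by blast
    obtain r2 where r2: "r2 > 0" "{g \<in> X. N (\<lambda>v. b v - g v) < r2} \<subseteq> W"
      using UW(2,4) unfolding openin_norm_topology by blast
    define e where "e = min r1 r2 / 2"
    have e: "e > 0" "e + e \<le> r1" "e + e \<le> r2" using r1 r2 by (auto simp: e_def)
    obtain a' where a': "a' \<in> D" "N (\<lambda>v. a v - a' v) < e" using D(3)[OF ab(2) e(1)] by blast
    obtain b' where b': "b' \<in> D" "N (\<lambda>v. b v - b' v) < e" using D(3)[OF ab(3) e(1)] by blast
    have "countable (D \<times> D)" using D(1) by simp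
    then obtain i where i: "from_nat_into (D \<times> D) i = (a', b')"
      using from_nat_into_surj[of "D \<times> D" "(a', b')"] a' b' by auto
    obtain m where m: "\<And>k. k \<ge> m \<Longrightarrow> A * (1 / 2) ^ k < e"
      using eventually_mult_power_less[of "1 / 2" e A] e(1) unfolding eventually_sequentially by auto
    \<comment> \<open>The component \<open>i\<close> selects the pair, and
      \<open>m \<le> prod_encode (i, m)\<close> makes the error \<open>A * (1 / 2) ^ k\<close>
      smaller than \<open>e\<close>.\<close>
    define k where "k = prod_encode (i, m)"
    have k: "k \<ge> m" "G k = (a', b')" using le_prod_encode_2 by (auto simp: k_def G_def i)
    have X: "(lattice_shift ^^ n k) x \<in> X" "(lattice_shift ^^ n k) y \<in> X"
      using x y by (auto intro: shift_iter_mem)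
    have "N (\<lambda>v. a v - (lattice_shift ^^ n k) x v) < r1"
      using triangle_diff[OF ab(2) DX[OF a'(1)] X(1)] a'(2) x(2)[of k] m[OF k(1)] e(2) by (simp add: k(2))
    moreover have "N (\<lambda>v. b v - (lattice_shift ^^ n k) y v) < r2"
      using triangle_diff[OF ab(3) DX[OF b'(1)] X(2)] b'(2) y(2)[of k] m[OF k(1)] e(3) by (simp add: k(2))
    ultimately have "((lattice_shift ^^ n k) x, (lattice_shift ^^ n k) y) \<in> T"
      using X r1(2) r2(2) UW(5) by blast
    then show "\<exists>q. q \<in> ?O \<and> q \<in> T"
      by (metis funpow_map_prod rangeI)
  qed
  then have "prod_topology ?\<T> ?\<T> closure_of ?O = topspace (prod_topology ?\<T> ?\<T>)"
    using closure_of_subset_topspace[of "prod_topology ?\<T> ?\<T>" ?O] by auto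
  then show ?thesis
    using x(1) y(1) unfolding weakly_mixing_on_def hypercyclic_on_def by (intro bexI[of _ "(x, y)"]) auto
qed

end

theorem theorem2p3:
  fixes \<mu> :: "nat \<times> nat \<Rightarrow> complex"
    and X :: "(nat \<times> nat \<Rightarrow> complex) set"
    and N :: "(nat \<times> nat \<Rightarrow> complex) \<Rightarrow> real"
    and B :: "(nat \<times> nat \<Rightarrow> complex) \<Rightarrow> (nat \<times> nat \<Rightarrow> complex)"
  defines "B \<equiv> backward_shift lattice_verts lattice_edges"
  assumes weight: "weight_on lattice_verts \<mu>"
    and space: "(\<exists>p\<ge>1. X = lp_space p lattice_verts \<mu> \<and> N = lp_norm p lattice_verts \<mu>) \<or>
                (X = c0_space lattice_verts \<mu> \<and> N = c0_norm lattice_verts \<mu>)"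
    and bounded: "bounded_operator_on X N B"
  shows "(Limsup lattice_at_infinity
            (\<lambda>(i, j). ereal (cmod (\<mu> (i, j)) powr (1 / real (i + j)))) < 2 \<longrightarrow>
          mixing_on (norm_topology X N) B \<and>
          weakly_mixing_on (norm_topology X N) B \<and>
          hypercyclic_on (norm_topology X N) B) \<and>
         ((\<exists>c::real. c > 0 \<and>
             (\<forall>(i, j)\<in>lattice_verts. cmod (\<mu> (i, j)) \<ge> c * 2 ^ (i + j))) \<longrightarrow>
          \<not> hypercyclic_on (norm_topology X N) B)"
proof -
  have "lattice_verts \<noteq> {}" by (auto simp: lattice_verts_def)
  then have "weighted_sequence_space lattice_verts \<mu> X N"
    using space weighted_sequence_space_lp weighted_sequence_space_c0 by blast
  then interpret lattice_sequence_space \<mu> X N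
    using weight bounded unfolding B_def
    by (intro lattice_sequence_space.intro lattice_sequence_space_axioms.intro)
  show ?thesis
    unfolding B_def using mixing weakly_mixing weakly_mixing_imp_hypercyclic[OF weakly_mixing] not_hypercyclic
    by blast
qed

end
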